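(* Let $\pi_{n,d}$ be the representation induced by the natural action of $G:=\mathrm{SL}(n)^d$ on $(\mathbb{C}^n)^{\otimes d}$. Then: (a) If $n=2$ and $d\geq3$, then $\gamma_T(\pi_{2,d})\leq\gamma_G(\pi_{2,d})\leq 2^{-\frac d2+1}$. (b) If $n\geq3$ and $d=3$, then $\gamma_T(\pi_{n,3})\leq\gamma_G(\pi_{n,3})\leq 2^{-n+1}$. (c) If $n\geq3$ and $d=6r-3$ for some integer $r\geq2$, then $$\gamma_T(\pi_{n,d})\leq\gamma_G(\pi_{n,d})\leq\frac{\sqrt6}{(n-1)\sqrt r}2^{-r(n-1)+1}\leq 2^{-r(n-1)+1}=2^{-\frac{(d+3)(n-1)}{6}+1}.$$
   Context: $\pi_{n,d}:\mathrm{SL}(n)^d\to\mathrm{GL}((\mathbb{C}^n)^{\otimes d})$, $(g_1,\dots,g_d)\mapsto g_1\otimes\cdots\otimes g_d$, with the standard Hermitian inner product on $(\mathbb{C}^n)^{\otimes d}$. Let $G=\mathrm{SL}(n)^d$, $K=\mathrm{SU}(n)^d$, $T=\mathrm{ST}(n)^d$ (tuples of diagonal determinant-one matrices), $T_K=K\cap T$, viewed block-diagonally. For $A=(A_1,\dots,A_d)$ let $\Pi(A)=\sum_k I\otimes\cdots\otimes A_k\otimes\cdots\otimes I$. The moment map $\mu_G(v)$, for $v\neq0$, is the unique $d$-tuple of traceless Hermitian matrices with $\operatorname{tr}(\mu_G(v)A)=\langle v,\Pi(A)v\rangle/\langle v,v\rangle$ for all $d$-tuples $A$ of traceless Hermitian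 matrices (trace of block-diagonal matrices); $\mu_T(v)$ is defined in the same way with $A$ ranging over $d$-tuples of real traceless diagonal matrices and $\mu_T(v)$ required to be such a tuple. A vector $v$ is $G$-unstable (resp. $T$-unstable) if $0$ lies in the closure of $G\cdot v$ (resp. $T\cdot v$). The gap is $\gamma_G(\pi):=\min\{\|\mu_G(v)\|_F: v\neq0\ G\text{-unstable}\}$ and the weight margin is $\gamma_T(\pi):=\min\{\|\mu_T(v)\|_F: v\neq0\ T\text{-unstable}\}$. *)

theory Defs
  imports "HOL-Analysis.Analysis"
begin

text \<open>
  The space of \<open>d\<close>-tensors over \<open>\<complex>\<^sup>n\<close> is \<open>complex ^ ('d \<Rightarrow> 'n)\<close> with \<open>n = CARD('n)\<close> and
  \<open>d = CARD('d)\<close>: the coordinate of a tensor at the multi-index \<open>I\<close> is its coefficient at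
  the tensor product of the standard basis vectors \<open>e (I k)\<close>, so its library norm and topology
  are the ones of the standard Hermitian inner product.
  A \<open>d\<close>-tuple of matrices \<open>A\<close>, with \<open>k\<close>-th matrix \<open>A $ k\<close>, stands for the corresponding
  block-diagonal matrix.
\<close>

type_synonym ('n, 'd) tensor = "complex ^ ('d \<Rightarrow> 'n)"
type_synonym ('n, 'd) mat_tuple = "complex ^ 'n ^ 'n ^ 'd"

definition hinner :: "complex ^ 'i \<Rightarrow> complex ^ 'i \<Rightarrow> complex" where
  "hinner v w = (\<Sum>i\<in>UNIV. cnj (v $ i) * w $ i)"

definition hermitian_matrix :: "complex ^ 'n ^ 'n \<Rightarrow> bool" where
  "hermitian_matrix A \<longleftrightarrow> (\<forall>i j. A $ i $ j = cnj (A $ j $ i))"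

definition diagonal_matrix :: "complex ^ 'n ^ 'n \<Rightarrow> bool" where
  "diagonal_matrix A \<longleftrightarrow> (\<forall>i j. i \<noteq> j \<longrightarrow> A $ i $ j = 0)"

definition real_matrix :: "complex ^ 'n ^ 'n \<Rightarrow> bool" where
  "real_matrix A \<longleftrightarrow> (\<forall>i j. A $ i $ j \<in> \<real>)"

text \<open>The matrix of \<open>A\<^sub>1 \<otimes> \<dots> \<otimes> A\<^sub>d\<close> (Kronecker product) in the standard basis; restricted to
  \<open>SL_tuples\<close> it is the representation \<open>\<pi>\<close>.\<close>

definition tensor_matrix ::
  "('n::finite, 'd::finite) mat_tuple \<Rightarrow> complex ^ ('d \<Rightarrow> 'n) ^ ('d \<Rightarrow> 'n)" where
  "tensor_matrix A = (\<chi> I J. \<Prod>k\<in>UNIV. A $ k $ I k $ J k)"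

definition tensor_lie_matrix ::
  "('n::finite, 'd::finite) mat_tuple \<Rightarrow> complex ^ ('d \<Rightarrow> 'n) ^ ('d \<Rightarrow> 'n)" where
  "tensor_lie_matrix A = (\<Sum>k\<in>UNIV. tensor_matrix (\<chi> l. if l = k then A $ k else mat 1))"

definition SL_tuples :: "('n::finite, 'd::finite) mat_tuple set" where
  "SL_tuples = {g. \<forall>k. det (g $ k) = 1}"

definition ST_tuples :: "('n::finite, 'd::finite) mat_tuple set" where
  "ST_tuples = {g. \<forall>k. diagonal_matrix (g $ k) \<and> det (g $ k) = 1}"

definition unstable ::
  "('n::finite, 'd::finite) mat_tuple set \<Rightarrow> ('n, 'd) tensor \<Rightarrow> bool" where
  "unstable H v \<longleftrightarrow> 0 \<in> closure ((\<lambda>g. tensor_matrix g *v v) ` H)"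

definition traceless_hermitian_tuples :: "('n::finite, 'd::finite) mat_tuple set" where
  "traceless_hermitian_tuples = {A. \<forall>k. hermitian_matrix (A $ k) \<and> trace (A $ k) = 0}"

definition traceless_real_diagonal_tuples :: "('n::finite, 'd::finite) mat_tuple set" where
  "traceless_real_diagonal_tuples =
     {A. \<forall>k. diagonal_matrix (A $ k) \<and> real_matrix (A $ k) \<and> trace (A $ k) = 0}"

text \<open>The trace of the product of the block-diagonal matrices given by two tuples.\<close>

definition trace_form ::
  "('n::finite, 'd::finite) mat_tuple \<Rightarrow> ('n, 'd) mat_tuple \<Rightarrow> complex" where
  "trace_form A B = (\<Sum>k\<in>UNIV. trace (A $ k ** B $ k))"

definition is_moment ::
  "('n::finite, 'd::finite) mat_tuple set \<Rightarrow> ('n, 'd) tensor \<Rightarrow> ('n, 'd) mat_tuple \<Rightarrow> bool" where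
  "is_moment S v M \<longleftrightarrow> M \<in> S \<and>
     (\<forall>A\<in>S. trace_form M A = hinner v (tensor_lie_matrix A *v v) / hinner v v)"

definition moment_G :: "('n::finite, 'd::finite) tensor \<Rightarrow> ('n, 'd) mat_tuple" where
  "moment_G v = (THE M. is_moment traceless_hermitian_tuples v M)"

definition moment_T :: "('n::finite, 'd::finite) tensor \<Rightarrow> ('n, 'd) mat_tuple" where
  "moment_T v = (THE M. is_moment traceless_real_diagonal_tuples v M)"

text \<open>The library norm of a tuple of matrices is the Frobenius norm of the block-diagonal matrix.\<close>

lemma norm_mat_tuple_eq_frobenius:
  fixes A :: "('n::finite, 'd::finite) mat_tuple"
  shows "norm A = sqrt (\<Sum>k\<in>UNIV. \<Sum>i\<in>UNIV. \<Sum>j\<in>UNIV. (cmod (A $ k $ i $ j))\<^sup>2)"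
  by (simp add: norm_vec_def L2_set_def sum_nonneg)

text \<open>\<open>LEAST\<close> renders the minimum: its value is meaningful only once the minimum is shown to be
  attained.\<close>

definition gap :: "'n::finite itself \<Rightarrow> 'd::finite itself \<Rightarrow> real" where
  "gap _ _ =
     (LEAST x. x \<in> {norm (moment_G v) | v :: ('n, 'd) tensor. v \<noteq> 0 \<and> unstable SL_tuples v})"

definition weight_margin :: "'n::finite itself \<Rightarrow> 'd::finite itself \<Rightarrow> real" where
  "weight_margin _ _ =
     (LEAST x. x \<in> {norm (moment_T v) | v :: ('n, 'd) tensor. v \<noteq> 0 \<and> unstable ST_tuples v})"

end

theory Submission
  imports Defs
begin

text \<open>
  By the singular value decomposition and compactness of the unitary group, a tensor is
  \<open>SL\<close>-unstable iff some unitary translate of it is \<open>ST\<close>-unstable, i.e. iff some traceless real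
  diagonal tuple \<open>\<theta>\<close> has positive weight on the support of the translate. Hence both null cones are
  closed, both minima are attained, and the weight margin is at most the gap, because the moment map
  of the torus is the diagonal part of the moment map of the full group.

  For the upper bounds, a tensor whose support consists of multi-indices that pairwise differ in at
  least two places has a diagonal moment map, with the deviations of the one-dimensional marginals of
  \<open>|v\<^sub>I|\<^sup>2\<close> from the uniform distribution on the diagonal. Almost uniform marginals on an unstable
  support are obtained by stacking blocks of tensor factors. A block has exactly uniform marginals
  except for a mass \<open>\<epsilon>\<close> missing at one state; attaching a further block at this state multiplies the
  total deviation by \<open>\<epsilon>\<close>. Here \<open>\<epsilon> = 1/2\<close> for two qubits, and
  \<open>\<epsilon> = 2\<^bsup>1-n\<^esup> / n\<close> for three factors of dimension \<open>n\<close>.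
\<close>

section \<open>Unitary matrices and the spectral theorem\<close>

text \<open>Attaching a block at one state of a head block obliges every other head state to be
  continued too, without disturbing the marginals or the signs of the weights. Neutral families
  serve this purpose. For two and three qubits they are explicit. For the ladder of three factors
  none is constructed; using every state of it twice leaves enough freedom in the weights to build
  one, at the price of six factors. The outermost block is never attached to anything and stays a
  plain ladder, whence \<open>d = 3 + 6 * (r - 1)\<close>. The innermost block has to end the stack:
  its missing mass is removed by rescaling, which leaves a deviation of at most
  \<open>sqrt 6 / (n - 1) * q\<close> with \<open>q = 2 powr (1 - n)\<close>. The other
  \<open>r - 1\<close> blocks contribute a factor \<open>q / n\<close> each. The powers of
  \<open>q\<close> make up the exponential in the bound, and \<open>n ^ (r - 1)\<close> dominates
  the \<open>sqrt r\<close> of the statement. The number \<open>q / n\<close> itself is the lowest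
  mass on a ladder whose masses double at each of its steps and must end at
  \<open>1 / (2 * n)\<close>.\<close>

definition adj_mat :: "complex ^ 'n ^ 'm \<Rightarrow> complex ^ 'm ^ 'n" where
  "adj_mat A = (\<chi> i j. cnj (A $ j $ i))"

definition unitary_matrix :: "complex ^ 'n ^ 'n \<Rightarrow> bool" where
  "unitary_matrix U \<longleftrightarrow> U ** adj_mat U = mat 1"

lemma adj_mat_nth [simp]: "adj_mat A $ i $ j = cnj (A $ j $ i)"
  by (simp add: adj_mat_def)

lemma adj_mat_adj_mat [simp]: "adj_mat (adj_mat A) = A"
  by (simp add: vec_eq_iff)

lemma adj_mat_mult: "adj_mat (A ** B) = adj_mat B ** adj_mat A"
  by (simp add: vec_eq_iff matrix_matrix_mult_def mult.commute)

lemma adj_mat_1 [simp]: "adj_mat (mat 1) = mat 1"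
  by (simp add: vec_eq_iff mat_def)

lemma det_adj_mat: "det (adj_mat A) = cnj (det A)"
proof -
  have "adj_mat A = transpose (\<chi> i j. cnj (A $ i $ j))"
    by (simp add: vec_eq_iff transpose_def)
  then have "det (adj_mat A) = det (\<chi> i j. cnj (A $ i $ j))"
    by (simp add: det_transpose)
  also have "\<dots> = cnj (det A)"
    by (simp add: det_def)
  finally show ?thesis .
qed

lemma hermitian_matrix_iff_adj: "hermitian_matrix A \<longleftrightarrow> adj_mat A = A"
  by (metis adj_mat_nth hermitian_matrix_def vec_eq_iff)

lemma unitary_matrix_left: "unitary_matrix U \<Longrightarrow> adj_mat U ** U = mat 1"
  unfolding unitary_matrix_def by (metis matrix_left_right_inverse)

lemma unitary_matrix_adj: "unitary_matrix U \<Longrightarrow> unitary_matrix (adj_mat U)"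
  using unitary_matrix_left by (simp add: unitary_matrix_def)

lemma unitary_matrix_1 [simp]: "unitary_matrix (mat 1)"
  by (simp add: unitary_matrix_def)

lemma cmod_det_unitary:
  assumes "unitary_matrix U" shows "cmod (det U) = 1"
proof -
  have "det U * cnj (det U) = 1"
    using assms unfolding unitary_matrix_def by (metis det_adj_mat det_I det_mul)
  then have "cmod (det U) * cmod (det U) = 1"
    by (metis complex_mod_cnj norm_mult norm_one)
  then show ?thesis
    by (metis abs_norm_cancel abs_square_eq_1 power2_eq_square)
qed

lemma unitary_matrix_iff_rows:
  "unitary_matrix U \<longleftrightarrow> (\<forall>i j. hinner (U $ j) (U $ i) = (if i = j then 1 else 0))"
  by (auto simp: unitary_matrix_def vec_eq_iff matrix_matrix_mult_def hinner_def mat_def mult.commute)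

lemma norm_vec_hinner: "complex_of_real ((norm v)\<^sup>2) = hinner v v"
  by (simp add: hinner_def norm_vec_def L2_set_def sum_nonneg complex_norm_square mult.commute
      del: of_real_power)

lemma norm_matrix_power2: "(norm (A :: complex ^ 'n ^ 'm))\<^sup>2 = (\<Sum>i\<in>UNIV. (norm (A $ i))\<^sup>2)"
  by (simp add: norm_vec_def L2_set_def sum_nonneg)

lemma compact_unitary: "compact {U :: complex ^ 'n ^ 'n. unitary_matrix U}"
proof (rule compact_eq_bounded_closed[THEN iffD2], rule conjI)
  have "norm U = sqrt (real CARD('n))" if "unitary_matrix U" for U :: "complex ^ 'n ^ 'n"
  proof -
    have "complex_of_real ((norm (U $ i))\<^sup>2) = 1" for i
      using that by (simp add: norm_vec_hinner unitary_matrix_iff_rows del: of_real_power)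
    then have "(norm (U $ i))\<^sup>2 = 1" for i
      by (metis of_real_eq_1_iff)
    then have "(norm U)\<^sup>2 = real CARD('n)"
      by (simp add: norm_matrix_power2)
    then show ?thesis
      by (metis norm_ge_zero real_sqrt_unique)
  qed
  then show "bounded {U :: complex ^ 'n ^ 'n. unitary_matrix U}"
    by (intro boundedI[where B = "sqrt (real CARD('n))"]) simp
  have "{U :: complex ^ 'n ^ 'n. unitary_matrix U} =
      (\<Inter>i. \<Inter>j. {U. (\<Sum>k\<in>UNIV. cnj (U $ j $ k) * U $ i $ k) = (if i = j then 1 else 0)})"
    by (auto simp: unitary_matrix_iff_rows hinner_def)
  moreover have "closed \<dots>"
    by (intro closed_INT ballI closed_Collect_eq continuous_intros)
  ultimately show "closed {U :: complex ^ 'n ^ 'n. unitary_matrix U}"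
    by simp
qed

text \<open>Row-vector convention: linear in the first argument and conjugate-linear in the second,
  opposite to \<open>hinner\<close>. The entries of \<open>U ** P ** adj_mat U\<close> thereby
  become values at pairs of rows of \<open>U\<close>.\<close>

definition herm_form :: "complex ^ 'n ^ 'n \<Rightarrow> complex ^ 'n \<Rightarrow> complex ^ 'n \<Rightarrow> complex" where
  "herm_form P x y = (\<Sum>a\<in>UNIV. \<Sum>b\<in>UNIV. x $ a * P $ a $ b * cnj (y $ b))"

lemma herm_form_conj:
  "(U ** P ** adj_mat U) $ i $ j = herm_form P (U $ i) (U $ j)"
proof -
  have "(U ** P ** adj_mat U) $ i $ j
      = (\<Sum>b\<in>UNIV. \<Sum>a\<in>UNIV. U $ i $ a * P $ a $ b * cnj (U $ j $ b))"
    by (simp add: matrix_matrix_mult_def sum_distrib_right)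
  also have "\<dots> = (\<Sum>a\<in>UNIV. \<Sum>b\<in>UNIV. U $ i $ a * P $ a $ b * cnj (U $ j $ b))"
    by (rule sum.swap)
  finally show ?thesis
    by (simp add: herm_form_def)
qed

lemma herm_form_add_left: "herm_form P (x + y) z = herm_form P x z + herm_form P y z"
  by (simp add: herm_form_def algebra_simps sum.distrib)

lemma herm_form_add_right: "herm_form P z (x + y) = herm_form P z x + herm_form P z y"
  by (simp add: herm_form_def algebra_simps sum.distrib)

lemma herm_form_smult_left: "herm_form P (c *s x) y = c * herm_form P x y"
  by (simp add: herm_form_def sum_distrib_left mult.assoc)

lemma herm_form_smult_right: "herm_form P x (c *s y) = cnj c * herm_form P x y"
  by (simp add: herm_form_def sum_distrib_left mult_ac)

lemma herm_form_diff_left: "herm_form P (x - y) z = herm_form P x z - herm_form P y z"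
  by (simp add: herm_form_def algebra_simps sum_subtractf)

lemma herm_form_diff_right: "herm_form P z (x - y) = herm_form P z x - herm_form P z y"
  by (simp add: herm_form_def algebra_simps sum_subtractf)

lemmas herm_form_simps = herm_form_diff_left herm_form_diff_right
  herm_form_add_left herm_form_add_right herm_form_smult_left herm_form_smult_right

lemma herm_form_cnj:
  assumes "hermitian_matrix P" shows "cnj (herm_form P x y) = herm_form P y x"
proof -
  have P: "cnj (P $ a $ b) = P $ b $ a" for a b
    using assms by (metis hermitian_matrix_def)
  have "cnj (herm_form P x y) = (\<Sum>a\<in>UNIV. \<Sum>b\<in>UNIV. cnj (x $ a) * P $ b $ a * y $ b)"
    by (simp add: herm_form_def P)
  also have "\<dots> = (\<Sum>b\<in>UNIV. \<Sum>a\<in>UNIV. cnj (x $ a) * P $ b $ a * y $ b)"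
    by (rule sum.swap)
  finally show ?thesis
    by (simp add: herm_form_def mult_ac)
qed

lemma herm_form_1: "herm_form (mat 1) x y = hinner y x"
proof -
  have "herm_form (mat 1) x y
      = (\<Sum>a\<in>UNIV. \<Sum>b\<in>UNIV. if a = b then x $ a * cnj (y $ b) else 0)"
    unfolding herm_form_def by (intro sum.cong refl) (simp add: mat_def)
  also have "\<dots> = hinner y x"
    by (simp add: hinner_def mult.commute)
  finally show ?thesis .
qed

text \<open>For \<open>p \<noteq> q\<close> and \<open>c\<^sup>2 + (cmod s)\<^sup>2 = 1\<close> this
  is left multiplication by a unitary rotation in the plane of the coordinates \<open>p\<close> and
  \<open>q\<close>; of the diagonal of \<open>U ** P ** adj_mat U\<close> it moves only two
  entries.\<close>

definition rotate_rows ::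
  "'n \<Rightarrow> 'n \<Rightarrow> real \<Rightarrow> complex \<Rightarrow> complex ^ 'n ^ 'n \<Rightarrow> complex ^ 'n ^ 'n" where
  "rotate_rows p q c s U = (\<chi> i. if i = p then of_real c *s U $ p + s *s U $ q
     else if i = q then (- cnj s) *s U $ p + of_real c *s U $ q else U $ i)"

lemma unitary_rotate_rows:
  assumes U: "unitary_matrix U" and "p \<noteq> q" and cs: "c\<^sup>2 + (cmod s)\<^sup>2 = 1"
  shows "unitary_matrix (rotate_rows p q c s U)"
proof -
  have *: "herm_form (mat 1) (U $ i) (U $ j) = (if i = j then 1 else 0)" for i j
    using U by (simp add: herm_form_1 unitary_matrix_iff_rows)
  have "complex_of_real (c\<^sup>2 + (cmod s)\<^sup>2) = 1"
    using cs by simp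
  then have cs': "of_real c * of_real c + s * cnj s = 1"
    by (simp only: of_real_add complex_norm_square) (simp add: power2_eq_square)
  have "herm_form (mat 1) (rotate_rows p q c s U $ i) (rotate_rows p q c s U $ j)
      = (if i = j then 1 else 0)" for i j
    using \<open>p \<noteq> q\<close> cs' by (auto simp: rotate_rows_def herm_form_simps * algebra_simps)
  then show ?thesis
    by (simp add: herm_form_1 unitary_matrix_iff_rows)
qed

text \<open>A maximiser of \<open>\<Sum>\<^sub>i w\<^sub>i (U P U\<^sup>*)\<^sub>i\<^sub>i\<close> with distinct weights diagonalises \<open>P\<close>:
  a nonzero entry at \<open>(p, q)\<close> would allow an infinitesimal rotation to increase the sum.\<close>

theorem spectral_theorem:
  fixes P :: "complex ^ 'n ^ 'n"
  assumes P: "hermitian_matrix P"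
  obtains U where "unitary_matrix U" "diagonal_matrix (U ** P ** adj_mat U)"
proof -
  obtain w0 :: "'n \<Rightarrow> nat" where w0: "inj w0"
    using finite_imp_inj_to_nat_seg[of "UNIV :: 'n set"] by auto
  define w where "w = (\<lambda>i. real (w0 i))"
  have inj_w: "w i \<noteq> w j" if "i \<noteq> j" for i j
    using w0 that by (auto simp: w_def inj_def)
  define f where "f = (\<lambda>U :: complex ^ 'n ^ 'n. \<Sum>i\<in>UNIV. w i * Re (herm_form P (U $ i) (U $ i)))"
  have "continuous_on {U. unitary_matrix U} f"
    unfolding f_def herm_form_def by (intro continuous_intros)
  moreover have "{U :: complex ^ 'n ^ 'n. unitary_matrix U} \<noteq> {}"
    using unitary_matrix_1 by blast
  ultimately obtain U where U: "unitary_matrix U" and max: "\<And>V. unitary_matrix V \<Longrightarrow> f V \<le> f U"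
    using continuous_attains_sup[OF compact_unitary] by (metis mem_Collect_eq)
  let ?B = "\<lambda>i j. herm_form P (U $ i) (U $ j)"
  have "?B p q = 0" if "p \<noteq> q" for p q
  proof (rule ccontr)
    assume nz: "?B p q \<noteq> 0"
    define b where "b = cmod (?B p q)"
    define D where "D = w p - w q"
    define m where "m = Re (?B q q) - Re (?B p p)"
    have b: "b > 0" and D: "D \<noteq> 0"
      using nz inj_w[OF that] by (auto simp: b_def D_def)
    \<comment> \<open>The rotation below changes \<open>f\<close> by a positive multiple of
      \<open>2 * c\<close> plus an error of absolute value \<open>t * \<bar>m\<bar>\<close>, so
      \<open>t\<close> has to be small enough for the first-order gain to win.\<close>
    have "((\<lambda>t. 2 * sqrt (1 - t\<^sup>2 * b\<^sup>2) - t * \<bar>m\<bar>) \<longlongrightarrow> 2 * sqrt (1 - 0\<^sup>2 * b\<^sup>2) - 0 * \<bar>m\<bar>) (at_right 0)"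
      by (intro tendsto_intros)
    then have "\<forall>\<^sub>F t in at_right 0. 2 * sqrt (1 - t\<^sup>2 * b\<^sup>2) - t * \<bar>m\<bar> > 0"
      by (rule order_tendstoD) simp
    moreover have "((\<lambda>t. 1 - t\<^sup>2 * b\<^sup>2) \<longlongrightarrow> 1 - 0\<^sup>2 * b\<^sup>2) (at_right 0)"
      by (intro tendsto_intros)
    then have "\<forall>\<^sub>F t in at_right 0. 1 - t\<^sup>2 * b\<^sup>2 > 0"
      by (rule order_tendstoD) simp
    moreover have "\<forall>\<^sub>F t :: real in at_right 0. t > 0"
      by (simp add: eventually_at_right_less)
    ultimately have "\<forall>\<^sub>F t in at_right 0. t > 0 \<and> 1 - t\<^sup>2 * b\<^sup>2 > 0 \<and> 2 * sqrt (1 - t\<^sup>2 * b\<^sup>2) - t * \<bar>m\<bar> > 0"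
      by eventually_elim auto
    then obtain t where t: "t > 0" "1 - t\<^sup>2 * b\<^sup>2 > 0" "2 * sqrt (1 - t\<^sup>2 * b\<^sup>2) - t * \<bar>m\<bar> > 0"
      using eventually_happens' trivial_limit_at_right_real by blast
    define c where "c = sqrt (1 - t\<^sup>2 * b\<^sup>2)"
    \<comment> \<open>The phase of \<open>?B p q\<close> makes both cross terms real and equal;
      \<open>sgn D\<close> selects the direction in which the weighted sum grows.\<close>
    define s where "s = of_real (sgn D * t) * ?B p q"
    have cmod_s: "(cmod s)\<^sup>2 = t\<^sup>2 * b\<^sup>2"
      using D by (simp add: s_def b_def norm_mult power_mult_distrib abs_sgn_eq)
    have c2: "c\<^sup>2 = 1 - t\<^sup>2 * b\<^sup>2"
      using t by (simp add: c_def)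
    let ?V = "rotate_rows p q c s U"
    have V: "unitary_matrix ?V"
      using U that by (rule unitary_rotate_rows) (simp add: cmod_s c2)
    have Bqp: "?B q p = cnj (?B p q)"
      using herm_form_cnj[OF P] by metis
    have cnjs: "cnj s * ?B p q = of_real (sgn D * t * b\<^sup>2)"
      by (simp add: s_def b_def complex_norm_square mult_ac flip: of_real_power)
    have Bpp: "?B i i = of_real (Re (?B i i))" for i
      using herm_form_cnj[OF P] by (metis complex_cnj_cancel_iff Reals_cnj_iff of_real_Re)
    have s2: "s * cnj s = of_real (t\<^sup>2 * b\<^sup>2)"
      using cmod_s complex_norm_square[of s] by simp
    have cnjs': "s * cnj (?B p q) = of_real (sgn D * t * b\<^sup>2)"
      using arg_cong[OF cnjs, of cnj] by simp
    have Vp: "herm_form P (?V $ p) (?V $ p)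
        = c\<^sup>2 * ?B p p + c * (cnj s * ?B p q) + c * (s * cnj (?B p q)) + (s * cnj s) * ?B q q"
      by (simp add: rotate_rows_def herm_form_simps Bqp algebra_simps power2_eq_square)
    have Vq: "herm_form P (?V $ q) (?V $ q)
        = (s * cnj s) * ?B p p - c * (cnj s * ?B p q) - c * (s * cnj (?B p q)) + c\<^sup>2 * ?B q q"
      using that by (simp add: rotate_rows_def herm_form_simps Bqp algebra_simps power2_eq_square)
    have RVp: "Re (herm_form P (?V $ p) (?V $ p)) = Re (?B p p) + t\<^sup>2 * b\<^sup>2 * m + 2 * c * sgn D * t * b\<^sup>2"
      unfolding Vp cnjs cnjs' s2 
      by (subst Bpp[of p], subst Bpp[of q]) (simp add: c2 m_def algebra_simps flip: of_real_power)
    have RVq: "Re (herm_form P (?V $ q) (?V $ q)) = Re (?B q q) - t\<^sup>2 * b\<^sup>2 * m - 2 * c * sgn D * t * b\<^sup>2"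
      unfolding Vq cnjs cnjs' s2 
      by (subst Bpp[of p], subst Bpp[of q]) (simp add: c2 m_def algebra_simps flip: of_real_power)
    have split: "f W = w p * Re (herm_form P (W $ p) (W $ p)) + w q * Re (herm_form P (W $ q) (W $ q))
       + (\<Sum>i\<in>UNIV - {p} - {q}. w i * Re (herm_form P (W $ i) (W $ i)))" for W
      unfolding f_def using that by (subst sum.remove[of _ p], simp, simp, subst sum.remove[of _ q]) auto
    have "(\<Sum>i\<in>UNIV - {p} - {q}. w i * Re (herm_form P (?V $ i) (?V $ i)))
        = (\<Sum>i\<in>UNIV - {p} - {q}. w i * Re (?B i i))"
      by (intro sum.cong) (auto simp: rotate_rows_def)
    then have "f ?V - f U = D * (t\<^sup>2 * b\<^sup>2 * m + 2 * c * sgn D * t * b\<^sup>2)"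
      unfolding split RVp RVq by (simp add: D_def algebra_simps)
    also have "\<dots> = \<bar>D\<bar> * t * b\<^sup>2 * (2 * c + sgn D * t * m)"
      by (cases "D > 0") (use D in \<open>auto simp: sgn_if algebra_simps power2_eq_square\<close>)
    also have "\<dots> > 0"
    proof -
      have "\<bar>sgn D * t * m\<bar> = t * \<bar>m\<bar>"
        using D t by (simp add: abs_mult abs_sgn_eq)
      then have "2 * c + sgn D * t * m > 0"
        using t(3) by (simp add: c_def)
      then show ?thesis
        using D t b by simp
    qed
    finally show False
      using max[OF V] by simp
  qed
  then have "diagonal_matrix (U ** P ** adj_mat U)"
    by (simp add: diagonal_matrix_def herm_form_conj)
  with U show thesis
    by (rule that)
qed

section \<open>Diagonal factors and singular values\<close>

lemma diagonal_matrix_mult_nth: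
  assumes "diagonal_matrix A"
  shows "(A ** B) $ i $ j = A $ i $ i * B $ i $ j" "(B ** A) $ i $ j = B $ i $ j * A $ j $ j"
proof -
  have "(A ** B) $ i $ j = (\<Sum>k\<in>UNIV. if k = i then A $ i $ i * B $ i $ j else 0)"
    using assms unfolding matrix_matrix_mult_def diagonal_matrix_def vec_lambda_beta
    by (intro sum.cong) auto
  then show "(A ** B) $ i $ j = A $ i $ i * B $ i $ j"
    by simp
  have "(B ** A) $ i $ j = (\<Sum>k\<in>UNIV. if k = j then B $ i $ j * A $ j $ j else 0)"
    using assms unfolding matrix_matrix_mult_def diagonal_matrix_def vec_lambda_beta
    by (intro sum.cong) auto
  then show "(B ** A) $ i $ j = B $ i $ j * A $ j $ j"
    by simp
qed

text \<open>With \<open>g\<^sup>* g = h\<^sup>* a\<^sup>2 h\<close> from the spectral theorem, the remaining factor is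
  \<open>k = g h\<^sup>* a\<^sup>-\<^sup>1\<close>.\<close>

theorem singular_value_decomposition:
  fixes g :: "complex ^ 'n ^ 'n"
  assumes g: "det g \<noteq> 0"
  obtains k a h where "unitary_matrix k" "unitary_matrix h" "diagonal_matrix a" "g = k ** a ** h"
proof -
  let ?P = "adj_mat g ** g"
  have "hermitian_matrix ?P"
    unfolding hermitian_matrix_iff_adj adj_mat_mult by simp
  then obtain h where h: "unitary_matrix h" and diag: "diagonal_matrix (h ** ?P ** adj_mat h)"
    by (rule spectral_theorem)
  define D where "D = h ** ?P ** adj_mat h"
  have D_eq: "D = adj_mat (g ** adj_mat h) ** (g ** adj_mat h)"
    by (simp add: D_def adj_mat_mult matrix_mul_assoc)
  have detD: "det D \<noteq> 0"
    using g cmod_det_unitary[OF h] by (auto simp: D_eq det_mul det_adj_mat)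
  have Dii: "D $ i $ i = complex_of_real (\<Sum>l\<in>UNIV. (cmod ((g ** adj_mat h) $ l $ i))\<^sup>2)" for i
    unfolding D_eq of_real_sum complex_norm_square
    by (simp add: matrix_matrix_mult_def[of "adj_mat (g ** adj_mat h)"] mult.commute)
  define d where "d i = (\<Sum>l\<in>UNIV. (cmod ((g ** adj_mat h) $ l $ i))\<^sup>2)" for i
  have Dd: "D $ i $ j = (if i = j then complex_of_real (d i) else 0)" for i j
    using Dii[of i] diag by (auto simp: d_def diagonal_matrix_def simp flip: D_def)
  have "det D = (\<Prod>i\<in>UNIV. D $ i $ i)"
    by (rule det_diagonal) (simp add: Dd)
  then have nz: "d i \<noteq> 0" for i
    using detD Dd[of i i] by auto
  have "d i \<ge> 0" for i
    by (simp add: d_def sum_nonneg)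
  with nz have dpos: "d i > 0" for i
    by (simp add: less_le)
  define a :: "complex ^ 'n ^ 'n" where "a = (\<chi> i j. if i = j then of_real (sqrt (d i)) else 0)"
  define a' :: "complex ^ 'n ^ 'n" where "a' = (\<chi> i j. if i = j then of_real (1 / sqrt (d i)) else 0)"
  have da: "diagonal_matrix a" "diagonal_matrix a'"
    by (auto simp: a_def a'_def diagonal_matrix_def)
  have adja': "adj_mat a' = a'"
    by (simp add: a'_def vec_eq_iff)
  have a'a: "a' ** a = mat 1"
    unfolding vec_eq_iff diagonal_matrix_mult_nth[OF da(2)]
    using nz by (simp add: a_def a'_def mat_def)
  have a'Da': "a' ** D ** a' = mat 1"
    unfolding vec_eq_iff diagonal_matrix_mult_nth[OF da(2)]
    using dpos nz by (simp add: Dd a'_def mat_def field_simps abs_of_pos flip: of_real_mult)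
  define k where "k = g ** adj_mat h ** a'"
  have "adj_mat k ** k = a' ** D ** a'"
    by (simp add: k_def D_def adj_mat_mult adja' matrix_mul_assoc)
  then have "unitary_matrix (adj_mat k)"
    by (simp add: a'Da' unitary_matrix_def)
  then have "unitary_matrix k"
    using unitary_matrix_adj by fastforce
  moreover have "g = k ** a ** h"
    unfolding k_def using a'a unitary_matrix_left[OF h]
    by (metis matrix_mul_assoc matrix_mul_rid)
  ultimately show thesis
    using that h da(1) by blast
qed

section \<open>Tensor products of matrices and the moment maps\<close>

lemma tensor_matrix_nth: "tensor_matrix A $ I $ J = (\<Prod>k\<in>UNIV. A $ k $ I k $ J k)"
  by (simp add: tensor_matrix_def)

lemma tensor_matrix_mult:
  "tensor_matrix A ** tensor_matrix B = tensor_matrix (\<chi> k. A $ k ** B $ k)"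
proof -
  have "(\<Sum>L\<in>UNIV. (\<Prod>k\<in>UNIV. A $ k $ I k $ L k) * (\<Prod>k\<in>UNIV. B $ k $ L k $ J k))
      = (\<Prod>k\<in>UNIV. \<Sum>l\<in>UNIV. A $ k $ I k $ l * B $ k $ l $ J k)" for I J
    by (subst prod_sum_PiE) (auto simp: prod.distrib PiE_UNIV_domain)
  then show ?thesis
    by (simp add: vec_eq_iff tensor_matrix_nth matrix_matrix_mult_def)
qed

lemma tensor_matrix_1: "tensor_matrix (\<chi> k. mat 1) = mat 1"
  by (auto simp: vec_eq_iff tensor_matrix_nth mat_def fun_eq_iff)

lemma adj_mat_tensor_matrix: "adj_mat (tensor_matrix A) = tensor_matrix (\<chi> k. adj_mat (A $ k))"
  by (simp add: vec_eq_iff tensor_matrix_nth)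

lemma diagonal_tensor_matrix:
  fixes A :: "('n::finite, 'd::finite) mat_tuple"
  assumes "\<And>k. diagonal_matrix (A $ k)"
  shows "diagonal_matrix (tensor_matrix A)"
  unfolding diagonal_matrix_def tensor_matrix_nth
proof (intro allI impI)
  fix I J :: "'d \<Rightarrow> 'n" assume "I \<noteq> J"
  then obtain k where "I k \<noteq> J k"
    by auto
  then show "(\<Prod>k\<in>UNIV. A $ k $ I k $ J k) = 0"
    using assms[of k] by (auto simp: diagonal_matrix_def)
qed

lemma diagonal_matrix_vector_mult:
  assumes "diagonal_matrix A" shows "(A *v v) $ i = A $ i $ i * v $ i"
proof -
  have "(A *v v) $ i = (\<Sum>k\<in>UNIV. if k = i then A $ i $ i * v $ i else 0)"
    using assms unfolding matrix_vector_mult_def diagonal_matrix_def vec_lambda_beta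
    by (intro sum.cong) auto
  then show ?thesis
    by simp
qed

lemma hinner_adj: "hinner (A *v x) y = hinner x (adj_mat A *v y)"
proof -
  have "hinner (A *v x) y = (\<Sum>i\<in>UNIV. \<Sum>j\<in>UNIV. cnj (A $ i $ j) * cnj (x $ j) * y $ i)"
    by (simp add: hinner_def matrix_vector_mult_def sum_distrib_right)
  also have "\<dots> = (\<Sum>j\<in>UNIV. \<Sum>i\<in>UNIV. cnj (A $ i $ j) * cnj (x $ j) * y $ i)"
    by (rule sum.swap)
  finally show ?thesis
    by (simp add: hinner_def matrix_vector_mult_def sum_distrib_left mult_ac)
qed

lemma hinner_unitary: "unitary_matrix U \<Longrightarrow> hinner (U *v x) (U *v y) = hinner x y"
  by (simp add: hinner_adj matrix_vector_mul_assoc unitary_matrix_left)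

lemma norm_unitary:
  assumes "unitary_matrix U" shows "norm (U *v x) = norm x"
proof -
  have "complex_of_real ((norm (U *v x))\<^sup>2) = complex_of_real ((norm x)\<^sup>2)"
    unfolding norm_vec_hinner using assms by (rule hinner_unitary)
  then show ?thesis
    by (metis norm_ge_zero of_real_eq_iff power2_eq_iff_nonneg)
qed

lemma hinner_self_eq_0_iff: "hinner v v = 0 \<longleftrightarrow> v = 0"
  using norm_vec_hinner[of v] by (metis norm_eq_zero of_real_eq_0_iff zero_eq_power2)

lemma hinner_lie:
  fixes A :: "('n::finite, 'd::finite) mat_tuple"
  shows "hinner v (tensor_lie_matrix A *v v)
    = (\<Sum>k\<in>UNIV. hinner v (tensor_matrix (\<chi> l. if l = k then A $ k else mat 1) *v v))"
proof -
  have "hinner v (tensor_lie_matrix A *v v) = (\<Sum>I\<in>UNIV. \<Sum>J\<in>UNIV. \<Sum>k\<in>UNIV.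
      cnj (v $ I) * (tensor_matrix (\<chi> l. if l = k then A $ k else mat 1) $ I $ J * v $ J))"
    by (simp add: hinner_def matrix_vector_mult_def tensor_lie_matrix_def sum_distrib_left
        sum_distrib_right)
  also have "\<dots> = (\<Sum>I\<in>UNIV. \<Sum>k\<in>UNIV. \<Sum>J\<in>UNIV.
      cnj (v $ I) * (tensor_matrix (\<chi> l. if l = k then A $ k else mat 1) $ I $ J * v $ J))"
    by (intro sum.cong refl sum.swap)
  also have "\<dots> = (\<Sum>k\<in>UNIV. \<Sum>I\<in>UNIV. \<Sum>J\<in>UNIV.
      cnj (v $ I) * (tensor_matrix (\<chi> l. if l = k then A $ k else mat 1) $ I $ J * v $ J))"
    by (rule sum.swap)
  finally show ?thesis
    by (simp add: hinner_def matrix_vector_mult_def sum_distrib_left)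
qed

section \<open>Unitary changes of basis and reduced density matrices\<close>

definition unitary_tuples :: "('n::finite, 'd::finite) mat_tuple set" where
  "unitary_tuples = {h. \<forall>k. unitary_matrix (h $ k)}"

lemma unitary_tensor_matrix: "h \<in> unitary_tuples \<Longrightarrow> unitary_matrix (tensor_matrix h)"
  by (simp add: unitary_tuples_def unitary_matrix_def adj_mat_tensor_matrix tensor_matrix_mult
      tensor_matrix_1)

text \<open>Infinitesimal equivariance: conjugation turns the identity factors of each summand into
  \<open>adj_mat (h $ l) ** h $ l\<close>, which is again the identity, so only the factor carrying
  \<open>A $ k\<close> changes.\<close>

lemma hinner_lie_unitary:
  fixes A h :: "('n::finite, 'd::finite) mat_tuple"
  assumes h: "h \<in> unitary_tuples"
  shows "hinner (tensor_matrix h *v v) (tensor_lie_matrix A *v (tensor_matrix h *v v))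
    = hinner v (tensor_lie_matrix (\<chi> k. adj_mat (h $ k) ** A $ k ** h $ k) *v v)"
proof -
  have eq: "(\<chi> l. adj_mat (h $ l) ** ((if l = k then A $ k else mat 1) ** h $ l))
      = (\<chi> l. if l = k then adj_mat (h $ k) ** A $ k ** h $ k else mat 1)" for k
    using h by (subst vec_eq_iff) (simp add: unitary_tuples_def unitary_matrix_left matrix_mul_assoc)
  have "hinner (tensor_matrix h *v v) (tensor_matrix B *v (tensor_matrix h *v v))
      = hinner v (tensor_matrix (\<chi> l. adj_mat (h $ l) ** (B $ l ** h $ l)) *v v)"
    for B :: "('n, 'd) mat_tuple"
    by (simp add: hinner_adj adj_mat_tensor_matrix matrix_vector_mul_assoc tensor_matrix_mult)
  then show ?thesis
    unfolding hinner_lie by (simp only: eq vec_lambda_beta)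
qed

text \<open>The (unnormalised) reduced density matrix of the \<open>k\<close>-th tensor factor.\<close>

definition reduced :: "('n::finite, 'd::finite) tensor \<Rightarrow> 'd \<Rightarrow> complex ^ 'n ^ 'n" where
  "reduced v k = (\<chi> i j. \<Sum>I\<in>{I. I k = j}. cnj (v $ I) * v $ (I(k := i)))"

lemma sum_fun_split:
  fixes f :: "('d::finite \<Rightarrow> 'n::finite) \<Rightarrow> 'a::comm_monoid_add"
  shows "(\<Sum>I\<in>UNIV. f I) = (\<Sum>j\<in>UNIV. \<Sum>I\<in>{I. I k = j}. f I)"
  using sum.group[of UNIV UNIV "\<lambda>I. I k" f] by simp

text \<open>Partial trace: the matrix on the left has nonzero entries only between multi-indices
  that agree outside place \<open>k\<close>, so all the other places can be summed out.\<close>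

lemma hinner_tensor_single:
  fixes v :: "('n::finite, 'd::finite) tensor"
  shows "hinner v (tensor_matrix (\<chi> l. if l = k then B else mat 1) *v v)
    = trace (reduced v k ** B)"
proof -
  have entry: "tensor_matrix (\<chi> l. if l = k then B else mat 1) $ I $ J
      = (if J \<in> range (\<lambda>i. I(k := i)) then B $ I k $ J k else 0)" for I J :: "'d \<Rightarrow> 'n"
  proof (cases "J \<in> range (\<lambda>i. I(k := i))")
    case True
    then obtain i where J: "J = I(k := i)"
      by auto
    have "tensor_matrix (\<chi> l. if l = k then B else mat 1) $ I $ J
        = (\<Prod>l\<in>UNIV. if l = k then B $ I k $ J k else 1)"
      unfolding tensor_matrix_nth by (rule prod.cong) (auto simp: J mat_def)
    with True show ?thesis
      by simp
  next
    case False
    then have "J \<noteq> I(k := J k)"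
      by auto
    then obtain l where "l \<noteq> k" "I l \<noteq> J l"
      by (auto simp: fun_eq_iff split: if_splits)
    then have "tensor_matrix (\<chi> l. if l = k then B else mat 1) $ I $ J = 0"
      unfolding tensor_matrix_nth by (intro prod_zero) (auto simp: mat_def intro!: bexI[of _ l])
    with False show ?thesis
      by simp
  qed
  have inner: "(tensor_matrix (\<chi> l. if l = k then B else mat 1) *v v) $ I
      = (\<Sum>i\<in>UNIV. B $ I k $ i * v $ (I(k := i)))" for I
  proof -
    have "(tensor_matrix (\<chi> l. if l = k then B else mat 1) *v v) $ I
        = (\<Sum>J\<in>UNIV. if J \<in> range (\<lambda>i. I(k := i)) then B $ I k $ J k * v $ J else 0)"
      unfolding matrix_vector_mult_def by (simp add: entry if_distrib[of "\<lambda>x. x * _"] cong: if_cong)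
    also have "\<dots> = (\<Sum>J\<in>range (\<lambda>i. I(k := i)). B $ I k $ J k * v $ J)"
      by (simp add: sum.inter_restrict[symmetric])
    also have "\<dots> = (\<Sum>i\<in>UNIV. B $ I k $ i * v $ (I(k := i)))"
      by (subst sum.reindex) (auto simp: inj_on_def fun_upd_eqD)
    finally show ?thesis .
  qed
  have "hinner v (tensor_matrix (\<chi> l. if l = k then B else mat 1) *v v)
      = (\<Sum>I\<in>UNIV. \<Sum>i\<in>UNIV. cnj (v $ I) * v $ (I(k := i)) * B $ I k $ i)"
    by (simp add: hinner_def inner sum_distrib_left mult_ac)
  also have "\<dots> = (\<Sum>j\<in>UNIV. \<Sum>I\<in>{I. I k = j}. \<Sum>i\<in>UNIV. cnj (v $ I) * v $ (I(k := i)) * B $ j $ i)"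
    by (subst sum_fun_split[of _ k]) simp
  also have "\<dots> = (\<Sum>j\<in>UNIV. \<Sum>i\<in>UNIV. \<Sum>I\<in>{I. I k = j}. cnj (v $ I) * v $ (I(k := i)) * B $ j $ i)"
    by (intro sum.cong refl sum.swap)
  also have "\<dots> = (\<Sum>i\<in>UNIV. \<Sum>j\<in>UNIV. \<Sum>I\<in>{I. I k = j}. cnj (v $ I) * v $ (I(k := i)) * B $ j $ i)"
    by (rule sum.swap)
  also have "\<dots> = trace (reduced v k ** B)"
    by (simp add: trace_def matrix_matrix_mult_def reduced_def sum_distrib_right)
  finally show ?thesis .
qed

lemma hermitian_reduced: "hermitian_matrix (reduced v k)"
  unfolding hermitian_matrix_def reduced_def
proof (intro allI, simp)
  fix i j
  show "(\<Sum>I | I k = j. cnj (v $ I) * v $ I(k := i)) = (\<Sum>I | I k = i. v $ I * cnj (v $ I(k := j)))"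
    by (rule sum.reindex_bij_witness[of _ "\<lambda>I. I(k := j)" "\<lambda>I. I(k := i)"]) (auto simp: mult.commute)
qed

lemma trace_reduced: "trace (reduced v k) = hinner v v"
proof -
  have "hinner v v = (\<Sum>j\<in>UNIV. \<Sum>I\<in>{I. I k = j}. cnj (v $ I) * v $ I)"
    unfolding hinner_def by (rule sum_fun_split)
  also have "\<dots> = trace (reduced v k)"
    unfolding trace_def reduced_def by (auto intro!: sum.cong)
  finally show ?thesis ..
qed

section \<open>Explicit moment maps of the full group and of the torus\<close>

lemma hinner_self_real: "cnj (hinner v v) = hinner v v"
  by (simp add: hinner_def mult.commute)

text \<open>Normalised reduced density matrices made traceless. The subtracted multiple of the
  identity is invisible to pairings with traceless matrices.\<close>

definition moment_formula :: "('n::finite, 'd::finite) tensor \<Rightarrow> ('n, 'd) mat_tuple" where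
  "moment_formula v = (\<chi> k i j. reduced v k $ i $ j / hinner v v
     - (if i = j then 1 / of_nat CARD('n) else 0))"

lemma trace_matrix_mult: "trace (A ** B) = (\<Sum>i\<in>UNIV. \<Sum>j\<in>UNIV. A $ i $ j * B $ j $ i)"
  by (simp add: trace_def matrix_matrix_mult_def)

lemma is_moment_formula:
  fixes v :: "('n::finite, 'd::finite) tensor"
  assumes v: "v \<noteq> 0"
  shows "is_moment traceless_hermitian_tuples v (moment_formula v)"
  unfolding is_moment_def
proof (intro conjI ballI)
  have nz: "hinner v v \<noteq> 0"
    using v by (simp add: hinner_self_eq_0_iff)
  have "cnj (reduced v k $ j $ i) = reduced v k $ i $ j" for k i j
    by (metis hermitian_reduced hermitian_matrix_def)
  then have "hermitian_matrix (moment_formula v $ k)" for k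
    by (simp add: hermitian_matrix_def moment_formula_def hinner_self_real)
  moreover have "trace (moment_formula v $ k) = 0" for k
  proof -
    have "trace (moment_formula v $ k) = trace (reduced v k) / hinner v v - 1"
      by (simp add: trace_def moment_formula_def sum_subtractf sum_divide_distrib)
    then show ?thesis
      using nz by (simp add: trace_reduced)
  qed
  ultimately show "moment_formula v \<in> traceless_hermitian_tuples"
    by (simp add: traceless_hermitian_tuples_def)
  fix A :: "('n, 'd) mat_tuple"
  assume A: "A \<in> traceless_hermitian_tuples"
  have "trace (moment_formula v $ k ** A $ k) = trace (reduced v k ** A $ k) / hinner v v" for k
  proof -
    have "trace (moment_formula v $ k ** A $ k) = trace (reduced v k ** A $ k) / hinner v v
        - (\<Sum>i\<in>UNIV. \<Sum>j\<in>UNIV. (if i = j then A $ k $ j $ i / of_nat CARD('n) else 0))"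
      by (simp add: trace_matrix_mult moment_formula_def algebra_simps sum_subtractf sum_divide_distrib
          if_distrib[of "\<lambda>x. _ * x"] cong: if_cong)
    also have "(\<Sum>i\<in>UNIV. \<Sum>j\<in>UNIV. (if i = j then A $ k $ j $ i / of_nat CARD('n) else 0))
        = trace (A $ k) / of_nat CARD('n)"
      by (simp add: trace_def sum_divide_distrib)
    also have "trace (A $ k) = 0"
      using A by (simp add: traceless_hermitian_tuples_def)
    finally show ?thesis
      by simp
  qed
  then show "trace_form (moment_formula v) A = hinner v (tensor_lie_matrix A *v v) / hinner v v"
    by (simp add: trace_form_def hinner_lie hinner_tensor_single sum_divide_distrib)
qed

lemma trace_form_self:
  fixes A :: "('n::finite, 'd::finite) mat_tuple"
  assumes "\<And>k. hermitian_matrix (A $ k)"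
  shows "trace_form A A = of_real ((norm A)\<^sup>2)"
proof -
  have "A $ k $ i $ j * A $ k $ j $ i = of_real ((cmod (A $ k $ i $ j))\<^sup>2)" for k i j
    unfolding complex_norm_square using assms[of k] by (metis hermitian_matrix_def)
  then show ?thesis
    by (simp add: trace_form_def trace_matrix_mult norm_mat_tuple_eq_frobenius sum_nonneg)
qed

lemma trace_form_diff_left: "trace_form (A - B) C = trace_form A C - trace_form B C"
  by (simp add: trace_form_def trace_matrix_mult algebra_simps sum_subtractf)

text \<open>The trace form is positive definite on Hermitian tuples, and the difference of two
  candidates, being itself a test tuple, pairs to zero with itself.\<close>

lemma is_moment_unique:
  assumes herm: "\<And>A k. A \<in> S \<Longrightarrow> hermitian_matrix (A $ k)"
    and diff: "\<And>A B. A \<in> S \<Longrightarrow> B \<in> S \<Longrightarrow> A - B \<in> S"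
    and M: "is_moment S v M" and N: "is_moment S v N"
  shows "M = N"
proof -
  have S: "M - N \<in> S"
    using M N diff by (simp add: is_moment_def)
  have "trace_form (M - N) (M - N) = 0"
    using M N S unfolding trace_form_diff_left is_moment_def by simp
  then have "complex_of_real ((norm (M - N))\<^sup>2) = 0"
    using trace_form_self[OF herm[OF S]] by simp
  then show ?thesis
    by simp
qed

lemma trace_diff: "trace (A - B) = trace A - trace B" for A B :: "complex ^ 'n ^ 'n"
  by (simp add: trace_def sum_subtractf)

lemma hermitian_matrix_diff:
  "hermitian_matrix A \<Longrightarrow> hermitian_matrix B \<Longrightarrow> hermitian_matrix (A - B)"
  by (simp add: hermitian_matrix_iff_adj vec_eq_iff)

lemma moment_G_unique:
  assumes "is_moment traceless_hermitian_tuples v M"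
  shows "moment_G v = M"
  unfolding moment_G_def
proof (rule the_equality[where P = "is_moment traceless_hermitian_tuples v", OF assms])
  fix N assume "is_moment traceless_hermitian_tuples v N"
  then show "N = M"
    by (rule is_moment_unique[rotated 2, OF _ assms])
      (simp_all add: traceless_hermitian_tuples_def hermitian_matrix_diff trace_diff)
qed

lemma moment_T_unique:
  assumes "is_moment traceless_real_diagonal_tuples v M"
  shows "moment_T v = M"
  unfolding moment_T_def
proof (rule the_equality[where P = "is_moment traceless_real_diagonal_tuples v", OF assms])
  have *: "hermitian_matrix A" if "diagonal_matrix A" "real_matrix A" for A :: "complex ^ 'n ^ 'n"
    using that unfolding hermitian_matrix_def diagonal_matrix_def real_matrix_def
    by (metis Reals_cnj_iff)
  fix N assume "is_moment traceless_real_diagonal_tuples v N"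
  then show "N = M"
    by (rule is_moment_unique[rotated 2, OF _ assms])
      (auto simp: traceless_real_diagonal_tuples_def diagonal_matrix_def real_matrix_def trace_diff
        intro: *[unfolded diagonal_matrix_def real_matrix_def])
qed

lemma moment_G_eq: "v \<noteq> 0 \<Longrightarrow> moment_G v = moment_formula v"
  by (intro moment_G_unique is_moment_formula)

definition diag_part :: "('n::finite, 'd::finite) mat_tuple \<Rightarrow> ('n, 'd) mat_tuple" where
  "diag_part M = (\<chi> k i j. if i = j then M $ k $ i $ i else 0)"

text \<open>A diagonal test tuple pairs only with the diagonal entries of the Hermitian moment, and
  these are real.\<close>

lemma moment_T_eq:
  fixes v :: "('n::finite, 'd::finite) tensor"
  assumes v: "v \<noteq> 0"
  shows "moment_T v = diag_part (moment_G v)"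
proof (rule moment_T_unique, unfold is_moment_def, intro conjI ballI)
  have M: "is_moment traceless_hermitian_tuples v (moment_G v)"
    using is_moment_formula[OF v] by (simp add: moment_G_eq[OF v])
  have herm: "hermitian_matrix (moment_G v $ k)" and tr: "trace (moment_G v $ k) = 0" for k
    using M by (auto simp: is_moment_def traceless_hermitian_tuples_def)
  have re: "moment_G v $ k $ i $ i \<in> \<real>" for k i
    using herm[of k] unfolding hermitian_matrix_def by (metis Reals_cnj_iff)
  have "trace (diag_part (moment_G v) $ k) = trace (moment_G v $ k)" for k
    by (simp add: trace_def diag_part_def)
  with re tr show "diag_part (moment_G v) \<in> traceless_real_diagonal_tuples"
    by (auto simp: traceless_real_diagonal_tuples_def diagonal_matrix_def real_matrix_def diag_part_def)
  fix A :: "('n, 'd) mat_tuple"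
  assume A: "A \<in> traceless_real_diagonal_tuples"
  have Ad: "diagonal_matrix (A $ k)" for k
    using A by (simp add: traceless_real_diagonal_tuples_def)
  have "A \<in> traceless_hermitian_tuples"
    using A unfolding traceless_real_diagonal_tuples_def traceless_hermitian_tuples_def
      hermitian_matrix_def diagonal_matrix_def real_matrix_def mem_Collect_eq
    by (metis Reals_cnj_iff)
  then have "trace_form (moment_G v) A = hinner v (tensor_lie_matrix A *v v) / hinner v v"
    using M by (simp add: is_moment_def)
  moreover have "trace_form (diag_part (moment_G v)) A = trace_form (moment_G v) A"
    unfolding trace_form_def trace_def diagonal_matrix_mult_nth(2)[OF Ad]
    by (simp add: diag_part_def)
  ultimately show "trace_form (diag_part (moment_G v)) A = hinner v (tensor_lie_matrix A *v v) / hinner v v"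
    by simp
qed

lemma norm_diag_part_le: "norm (diag_part M) \<le> norm M"
  unfolding norm_mat_tuple_eq_frobenius
  by (intro real_sqrt_le_mono sum_mono) (auto simp: diag_part_def)

lemma hermitian_conj:
  assumes "hermitian_matrix A" shows "hermitian_matrix (h ** A ** adj_mat h)"
  using assms unfolding hermitian_matrix_iff_adj adj_mat_mult by (simp add: matrix_mul_assoc)

text \<open>Equivariance: the conjugated tuple \<open>N\<close> satisfies the defining identity at
  the translated tensor, and conjugation preserves the trace form.\<close>

lemma norm_moment_G_unitary:
  fixes v :: "('n::finite, 'd::finite) tensor"
  assumes h: "h \<in> unitary_tuples" and v: "v \<noteq> 0"
  shows "norm (moment_G (tensor_matrix h *v v)) = norm (moment_G v)"
proof -
  let ?M = "moment_G v"
  define N where "N = (\<chi> k. h $ k ** ?M $ k ** adj_mat (h $ k))"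
  have hk: "unitary_matrix (h $ k)" for k
    using h by (simp add: unitary_tuples_def)
  have M: "is_moment traceless_hermitian_tuples v ?M"
    using is_moment_formula[OF v] by (simp add: moment_G_eq[OF v])
  have herm: "hermitian_matrix (?M $ k)" and tr: "trace (?M $ k) = 0" for k
    using M by (auto simp: is_moment_def traceless_hermitian_tuples_def)
  have hermN: "hermitian_matrix (N $ k)" for k
    using hermitian_conj[OF herm] by (simp add: N_def)
  have conj_tr: "trace (N $ k ** B) = trace (?M $ k ** (adj_mat (h $ k) ** B ** h $ k))" for k B
    unfolding N_def vec_lambda_beta using trace_mul_sym[of "h $ k"] by (metis matrix_mul_assoc)
  have "trace (N $ k) = 0" for k
    using conj_tr[of k "mat 1"] hk tr by (simp add: unitary_matrix_left)
  with hermN have NS: "N \<in> traceless_hermitian_tuples"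
    by (simp add: traceless_hermitian_tuples_def)
  have "is_moment traceless_hermitian_tuples (tensor_matrix h *v v) N"
    unfolding is_moment_def
  proof (intro conjI ballI NS)
    fix A :: "('n, 'd) mat_tuple"
    assume A: "A \<in> traceless_hermitian_tuples"
    define B where "B = (\<chi> k. adj_mat (h $ k) ** A $ k ** h $ k)"
    have "hermitian_matrix (B $ k)" for k
      using A hermitian_conj[of "A $ k" "adj_mat (h $ k)"]
      by (simp add: traceless_hermitian_tuples_def B_def)
    moreover have "trace (B $ k) = trace (A $ k)" for k
      unfolding B_def vec_lambda_beta using hk[of k]
      by (metis matrix_mul_assoc matrix_mul_rid trace_mul_sym unitary_matrix_def)
    ultimately have "B \<in> traceless_hermitian_tuples"
      using A by (simp add: traceless_hermitian_tuples_def)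
    then have "trace_form ?M B = hinner v (tensor_lie_matrix B *v v) / hinner v v"
      using M by (simp add: is_moment_def)
    moreover have "trace_form N A = trace_form ?M B"
      by (simp add: trace_form_def conj_tr B_def)
    ultimately show "trace_form N A =
        hinner (tensor_matrix h *v v) (tensor_lie_matrix A *v (tensor_matrix h *v v))
          / hinner (tensor_matrix h *v v) (tensor_matrix h *v v)"
      using h by (simp add: hinner_lie_unitary hinner_unitary unitary_tensor_matrix B_def)
  qed
  then have "moment_G (tensor_matrix h *v v) = N"
    by (rule moment_G_unique)
  moreover have "trace_form N N = trace_form ?M ?M"
  proof -
    have "adj_mat (h $ k) ** N $ k ** h $ k = ?M $ k" for k
      unfolding N_def vec_lambda_beta using unitary_matrix_left[OF hk[of k]]
      by (metis matrix_mul_assoc matrix_mul_lid matrix_mul_rid)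
    then show ?thesis
      by (simp add: trace_form_def conj_tr)
  qed
  then have "complex_of_real ((norm N)\<^sup>2) = complex_of_real ((norm ?M)\<^sup>2)"
    using trace_form_self[OF hermN] trace_form_self[OF herm] by simp
  then have "norm N = norm ?M"
    by (metis norm_ge_zero of_real_eq_iff power2_eq_iff_nonneg)
  ultimately show ?thesis
    by simp
qed

lemma continuous_on_moment_G:
  "continuous_on {v :: ('n::finite, 'd::finite) tensor. v \<noteq> 0} moment_G"
proof -
  have "continuous_on {v :: ('n, 'd) tensor. v \<noteq> 0} moment_formula"
    unfolding moment_formula_def reduced_def hinner_def
    by (intro continuous_intros) (auto simp flip: hinner_def simp: hinner_self_eq_0_iff)
  then show ?thesis
    by (rule continuous_on_eq) (simp add: moment_G_eq)
qed

lemma continuous_on_moment_T: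
  "continuous_on {v :: ('n::finite, 'd::finite) tensor. v \<noteq> 0} moment_T"
proof -
  have "continuous_on {v :: ('n, 'd) tensor. v \<noteq> 0} (\<lambda>v. if i = j then moment_G v $ k $ i $ i else 0)"
    for k i j
    by (cases "i = j") (auto intro!: continuous_intros continuous_on_moment_G)
  then have "continuous_on {v :: ('n, 'd) tensor. v \<noteq> 0}
      (\<lambda>v. \<chi> k i j. if i = j then moment_G v $ k $ i $ i else 0)"
    by (intro continuous_on_vec_lambda)
  then show ?thesis
    by (rule continuous_on_eq) (simp add: moment_T_eq diag_part_def)
qed

section \<open>The Hilbert--Mumford criterion\<close>

text \<open>The numerical criterion for the torus: \<theta> generates the one-parameter group of
  diagonal matrices with entries \<open>exp (- t * \<theta> k i)\<close>, and every coordinate in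
  the support decays along it. The zero tensor is included, which makes the set a closed
  cone.\<close>

definition destabilized :: "('n::finite, 'd::finite) tensor \<Rightarrow> bool" where
  "destabilized v \<longleftrightarrow> (\<exists>\<theta> :: 'd \<Rightarrow> 'n \<Rightarrow> real. (\<forall>k. (\<Sum>i\<in>UNIV. \<theta> k i) = 0) \<and>
     (\<forall>I. v $ I \<noteq> 0 \<longrightarrow> (\<Sum>k\<in>UNIV. \<theta> k (I k)) > 0))"

text \<open>Gordan's alternative.\<close>

lemma uniform_marginals_if_not_destabilized:
  fixes v :: "('n::finite, 'd::finite) tensor"
  assumes nd: "\<not> destabilized v"
  obtains c :: "('d \<Rightarrow> 'n) \<Rightarrow> real" where "\<And>I. c I \<ge> 0" "\<And>I. v $ I = 0 \<Longrightarrow> c I = 0"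
    "(\<Sum>I\<in>UNIV. c I) = 1" "\<And>k i. (\<Sum>I | I k = i. c I) = 1 / real CARD('n)"
proof -
  \<comment> \<open>The torus weight of the coordinate \<open>I\<close>: the indicators of its
    entries, projected to the traceless tuples.\<close>
  define f :: "('d \<Rightarrow> 'n) \<Rightarrow> real ^ 'n ^ 'd"
    where "f I = (\<chi> k i. (if I k = i then 1 else 0) - 1 / real CARD('n))" for I
  define S where "S = {I. v $ I \<noteq> 0}"
  have inj: "inj f"
  proof (rule injI, rule ext)
    fix I J k assume "f I = f J"
    then have "f I $ k $ I k = f J $ k $ I k"
      by simp
    then show "I k = J k"
      by (simp add: f_def split: if_splits)
  qed
  have "0 \<in> convex hull (f ` S)"
  proof (rule ccontr)
    assume "0 \<notin> convex hull (f ` S)"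
    then obtain a b where ab: "b > 0" "\<And>x. x \<in> convex hull (f ` S) \<Longrightarrow> a \<bullet> x > b"
      using separating_hyperplane_closed_0[OF convex_convex_hull, of "f ` S"]
        compact_imp_closed[OF finite_imp_compact_convex_hull, of "f ` S"] by fastforce
    \<comment> \<open>Removing the means makes the separating normal \<open>a\<close> traceless and
      turns its pairing with \<open>f I\<close> into the weight of \<open>I\<close>.\<close>
    define \<theta> where "\<theta> k i = a $ k $ i - (\<Sum>j\<in>UNIV. a $ k $ j) / real CARD('n)" for k i
    have "(\<Sum>i\<in>UNIV. \<theta> k i) = 0" for k
      by (simp add: \<theta>_def sum_subtractf)
    moreover have "(\<Sum>k\<in>UNIV. \<theta> k (I k)) > 0" if "v $ I \<noteq> 0" for I
    proof -
      have "a \<bullet> f I = (\<Sum>k\<in>UNIV. \<Sum>i\<in>UNIV. (if I k = i then a $ k $ i else 0) - a $ k $ i / real CARD('n))"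
        unfolding inner_vec_def f_def by (intro sum.cong refl) (simp add: algebra_simps)
      also have "\<dots> = (\<Sum>k\<in>UNIV. \<theta> k (I k))"
        by (simp add: \<theta>_def sum_subtractf sum_divide_distrib)
      finally show ?thesis
        using ab(1) ab(2)[of "f I"] that by (simp add: S_def hull_inc)
    qed
    ultimately show False
      using nd unfolding destabilized_def by blast
  qed
  then obtain u where u: "\<And>x. x \<in> f ` S \<Longrightarrow> 0 \<le> u x" "sum u (f ` S) = 1"
      "(\<Sum>x\<in>f ` S. u x *\<^sub>R x) = 0"
    by (auto simp: convex_hull_finite)
  define c where "c I = (if I \<in> S then u (f I) else 0)" for I
  have inj': "inj_on f S"
    using inj by (rule inj_on_subset) simp
  have sum_c: "(\<Sum>I\<in>UNIV. c I) = 1"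
    using u(2) by (simp add: c_def sum.reindex[OF inj'] flip: sum.inter_restrict)
  have "(\<Sum>I\<in>UNIV. c I *\<^sub>R f I) = (\<Sum>I\<in>UNIV. if I \<in> S then u (f I) *\<^sub>R f I else 0)"
    by (rule sum.cong) (auto simp: c_def)
  also have "\<dots> = 0"
    using u(3) by (simp add: sum.reindex[OF inj'] flip: sum.inter_restrict)
  finally have zero: "(\<Sum>I\<in>UNIV. c I *\<^sub>R f I) = 0" .
  have "(\<Sum>I | I k = i. c I) = 1 / real CARD('n)" for k i
  proof -
    have "0 = (\<Sum>I\<in>UNIV. c I *\<^sub>R f I) $ k $ i"
      by (simp add: zero)
    also have "\<dots> = (\<Sum>I\<in>UNIV. (if I k = i then c I else 0) - c I / real CARD('n))"
      unfolding sum_component by (intro sum.cong refl) (simp add: f_def algebra_simps)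
    also have "\<dots> = (\<Sum>I\<in>UNIV. (if I k = i then c I else 0)) - 1 / real CARD('n)"
      by (simp add: sum_subtractf sum_c flip: sum_divide_distrib)
    also have "(\<Sum>I\<in>UNIV. (if I k = i then c I else 0)) = (\<Sum>I | I k = i. c I)"
      by (simp add: sum.If_cases)
    finally show ?thesis
      by simp
  qed
  then show thesis
    using sum_c u(1) by (intro that[of c]) (auto simp: c_def S_def)
qed

text \<open>If the limit were not destabilized, Gordan's alternative would supply a monomial
  \<open>\<Prod>\<^sub>I |x\<^sub>I|\<^bsup>c I\<^esup>\<close> that is invariant under the torus and positive at the limit.\<close>

lemma destabilized_limit:
  fixes w :: "nat \<Rightarrow> ('n::finite, 'd::finite) tensor" and l :: "nat \<Rightarrow> 'd \<Rightarrow> 'n \<Rightarrow> real"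
  assumes l: "\<And>j k. (\<Sum>i\<in>UNIV. l j k i) = 0"
    and lim: "w \<longlonglongrightarrow> v"
    and zero: "\<And>I. (\<lambda>j. exp (\<Sum>k\<in>UNIV. l j k (I k)) * cmod (w j $ I)) \<longlonglongrightarrow> 0"
  shows "destabilized v"
proof (rule ccontr)
  assume "\<not> destabilized v"
  then obtain c :: "('d \<Rightarrow> 'n) \<Rightarrow> real" where c: "\<And>I. c I \<ge> 0" "\<And>I. v $ I = 0 \<Longrightarrow> c I = 0"
    "(\<Sum>I\<in>UNIV. c I) = 1" "\<And>k i. (\<Sum>I | I k = i. c I) = 1 / real CARD('n)"
    using uniform_marginals_if_not_destabilized by blast
  define S where "S = {I. c I > 0}"
  have S: "S \<noteq> {}"
  proof
    assume "S = {}"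
    then have "c I = 0" for I
      using c(1)[of I] by (auto simp: S_def not_less antisym)
    with c(3) show False
      by simp
  qed
  define F where "F x = (\<Prod>I\<in>S. x I powr c I)" for x
  define e where "e j I = exp (\<Sum>k\<in>UNIV. l j k (I k))" for j I
  \<comment> \<open>The uniform marginals of \<open>c\<close> turn the exponent into a multiple of
    the sum of all entries of \<open>l j\<close>, which is zero.\<close>
  have "F (e j) = 1" for j
  proof -
    have "(\<Sum>I\<in>S. c I * (\<Sum>k\<in>UNIV. l j k (I k))) = (\<Sum>I\<in>UNIV. c I * (\<Sum>k\<in>UNIV. l j k (I k)))"
      using c(1) by (intro sum.mono_neutral_left) (auto simp: S_def not_less antisym)
    also have "\<dots> = (\<Sum>k\<in>UNIV. \<Sum>I\<in>UNIV. c I * l j k (I k))"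
      unfolding sum_distrib_left by (rule sum.swap)
    also have "\<dots> = (\<Sum>k\<in>UNIV. \<Sum>i\<in>UNIV. \<Sum>I | I k = i. c I * l j k i)"
    proof (rule sum.cong[OF refl])
      fix k
      show "(\<Sum>I\<in>UNIV. c I * l j k (I k)) = (\<Sum>i\<in>UNIV. \<Sum>I | I k = i. c I * l j k i)"
        by (subst sum_fun_split[of _ k]) simp
    qed
    also have "\<dots> = (\<Sum>k\<in>UNIV. \<Sum>i\<in>UNIV. 1 / real CARD('n) * l j k i)"
      by (simp only: c(4) flip: sum_distrib_right)
    also have "\<dots> = 0"
      by (simp only: l flip: sum_distrib_left) simp
    finally show ?thesis
      unfolding F_def e_def powr_def by (simp flip: exp_sum)
  qed
  moreover have "F (\<lambda>I. e j I * cmod (w j $ I)) = F (e j) * F (\<lambda>I. cmod (w j $ I))" for j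
    unfolding F_def by (simp add: powr_mult e_def prod.distrib)
  ultimately have eq: "F (\<lambda>I. e j I * cmod (w j $ I)) = F (\<lambda>I. cmod (w j $ I))" for j
    by simp
  have nz: "v $ I \<noteq> 0" if "I \<in> S" for I
    using c(2)[of I] that by (auto simp: S_def)
  have "(\<lambda>j. F (\<lambda>I. cmod (w j $ I))) \<longlonglongrightarrow> F (\<lambda>I. cmod (v $ I))"
    unfolding F_def using nz
    by (intro tendsto_prod tendsto_powr tendsto_norm tendsto_vec_nth lim tendsto_const) auto
  moreover have "(\<lambda>j. F (\<lambda>I. e j I * cmod (w j $ I))) \<longlonglongrightarrow> F (\<lambda>I. 0)"
    unfolding F_def using zero
    by (intro tendsto_prod tendsto_powr' tendsto_const) (auto simp: S_def e_def)
  ultimately have "F (\<lambda>I. cmod (v $ I)) = F (\<lambda>I. 0)"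
    unfolding eq by (rule LIMSEQ_unique)
  moreover have "F (\<lambda>I. 0) = 0"
    using S by (simp add: F_def card_gt_0_iff)
  moreover have "F (\<lambda>I. cmod (v $ I)) > 0"
    unfolding F_def using nz by (intro prod_pos) auto
  ultimately show False
    by simp
qed

section \<open>From orbit closures to the numerical criterion\<close>

lemma compact_unitary_tuples: "compact (unitary_tuples :: ('n::finite, 'd::finite) mat_tuple set)"
proof (rule compact_eq_bounded_closed[THEN iffD2], rule conjI)
  let ?K = "{U :: complex ^ 'n ^ 'n. unitary_matrix U}"
  obtain B where B: "\<And>U :: complex ^ 'n ^ 'n. unitary_matrix U \<Longrightarrow> norm U \<le> B"
    using compact_imp_bounded[OF compact_unitary] unfolding bounded_iff by auto
  show "bounded (unitary_tuples :: ('n, 'd) mat_tuple set)"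
  proof (rule boundedI)
    fix h :: "('n, 'd) mat_tuple" assume h: "h \<in> unitary_tuples"
    have "norm h \<le> (\<Sum>k\<in>UNIV. norm (h $ k))"
      unfolding norm_vec_def by (rule L2_set_le_sum) simp
    also have "\<dots> \<le> (\<Sum>k\<in>(UNIV :: 'd set). B)"
      using h by (intro sum_mono B) (simp add: unitary_tuples_def)
    finally show "norm h \<le> (\<Sum>k\<in>(UNIV :: 'd set). B)" .
  qed
  have "unitary_tuples = (\<Inter>k. (\<lambda>h :: ('n, 'd) mat_tuple. h $ k) -` ?K)"
    by (auto simp: unitary_tuples_def)
  moreover have "closed \<dots>"
    by (intro closed_INT ballI closed_vimage compact_imp_closed compact_unitary continuous_intros)
  ultimately show "closed (unitary_tuples :: ('n, 'd) mat_tuple set)"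
    by simp
qed

lemma det_diagonal_matrix: "diagonal_matrix A \<Longrightarrow> det A = (\<Prod>i\<in>UNIV. A $ i $ i)"
  by (rule det_diagonal) (simp add: diagonal_matrix_def)

lemma tensor_matrix_diagonal_vec:
  fixes a :: "('n::finite, 'd::finite) mat_tuple"
  assumes "\<And>k. diagonal_matrix (a $ k)"
  shows "(tensor_matrix a *v v) $ I = (\<Prod>k\<in>UNIV. a $ k $ I k $ I k) * v $ I"
  using diagonal_tensor_matrix[OF assms] by (simp add: diagonal_matrix_vector_mult tensor_matrix_nth)

text \<open>Made for the diagonal factors of singular value decompositions: their determinants are
  controlled only up to a phase, and the unitary factors to their right let the vector vary with
  \<open>j\<close>. The exponents are the logarithms of the absolute values of the diagonal
  entries.\<close>

lemma destabilized_diagonal_limit: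
  fixes w :: "nat \<Rightarrow> ('n::finite, 'd::finite) tensor" and a :: "nat \<Rightarrow> ('n, 'd) mat_tuple"
  assumes diag: "\<And>j k. diagonal_matrix (a j $ k)" and det: "\<And>j k. cmod (det (a j $ k)) = 1"
    and lim: "w \<longlonglongrightarrow> v" and zero: "(\<lambda>j. tensor_matrix (a j) *v w j) \<longlonglongrightarrow> 0"
  shows "destabilized v"
proof (rule destabilized_limit[OF _ lim])
  have prod1: "(\<Prod>i\<in>UNIV. cmod (a j $ k $ i $ i)) = 1" for j k
    using det[of j k] by (simp add: det_diagonal_matrix[OF diag] prod_norm)
  have "cmod (a j $ k $ i $ i) \<noteq> 0" for j k i
    using prod1[of j k] prod_zero[of UNIV "\<lambda>i. cmod (a j $ k $ i $ i)"] by auto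
  then have pos: "cmod (a j $ k $ i $ i) > 0" for j k i
    by simp
  let ?l = "\<lambda>j k i. ln (cmod (a j $ k $ i $ i))"
  show "(\<Sum>i\<in>UNIV. ?l j k i) = 0" for j k
    using ln_prod[of UNIV "\<lambda>i. cmod (a j $ k $ i $ i)"] pos prod1[of j k] by simp
  show "(\<lambda>j. exp (\<Sum>k\<in>UNIV. ?l j k (I k)) * cmod (w j $ I)) \<longlonglongrightarrow> 0" for I
  proof -
    have "exp (\<Sum>k\<in>UNIV. ?l j k (I k)) * cmod (w j $ I) = cmod ((tensor_matrix (a j) *v w j) $ I)" for j
      using pos by (simp add: tensor_matrix_diagonal_vec diag exp_sum norm_mult prod_norm)
    then show ?thesis
      using tendsto_norm[OF tendsto_vec_nth[OF zero, of I]] by simp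
  qed
qed

lemma continuous_tensor_action:
  "continuous_on UNIV (\<lambda>p :: ('n::finite, 'd::finite) mat_tuple \<times> ('n, 'd) tensor. tensor_matrix (fst p) *v snd p)"
  unfolding tensor_matrix_def matrix_vector_mult_def by (intro continuous_intros)

lemma tendsto_tensor_action:
  fixes h :: "nat \<Rightarrow> ('n::finite, 'd::finite) mat_tuple"
  assumes "h \<longlonglongrightarrow> h0" "w \<longlonglongrightarrow> w0"
  shows "(\<lambda>j. tensor_matrix (h j) *v w j) \<longlonglongrightarrow> tensor_matrix h0 *v w0"
  using continuous_on_tendsto_compose[OF continuous_tensor_action tendsto_Pair[OF assms]] by simp

lemma destabilized_if_unstable_ST:
  assumes "unstable ST_tuples v" shows "destabilized v"
proof -
  obtain x where x: "\<And>j. x j \<in> (\<lambda>g. tensor_matrix g *v v) ` ST_tuples" "x \<longlonglongrightarrow> 0"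
    using assms unfolding unstable_def closure_sequential by blast
  then have "\<forall>j. \<exists>g. g \<in> ST_tuples \<and> x j = tensor_matrix g *v v"
    by blast
  then obtain g where g: "\<And>j. g j \<in> ST_tuples" "\<And>j. x j = tensor_matrix (g j) *v v"
    by metis
  show ?thesis
    by (rule destabilized_diagonal_limit[of g "\<lambda>j. v"])
      (use g x in \<open>auto simp: ST_tuples_def simp flip: g(2)\<close>)
qed

lemma destabilized_if_unstable_SL:
  fixes v :: "('n::finite, 'd::finite) tensor"
  assumes "unstable SL_tuples v"
  obtains h where "h \<in> unitary_tuples" "destabilized (tensor_matrix h *v v)"
proof -
  obtain x where x: "\<And>j. x j \<in> (\<lambda>g. tensor_matrix g *v v) ` SL_tuples" "x \<longlonglongrightarrow> 0"
    using assms unfolding unstable_def closure_sequential by blast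
  then have "\<forall>j. \<exists>g. g \<in> SL_tuples \<and> x j = tensor_matrix g *v v"
    by blast
  then obtain g where g: "\<And>j. g j \<in> SL_tuples" "\<And>j. x j = tensor_matrix (g j) *v v"
    by metis
  have "\<exists>k a h. unitary_matrix k \<and> unitary_matrix h \<and> diagonal_matrix a \<and> g j $ m = k ** a ** h" for j m
  proof -
    have "det (g j $ m) \<noteq> 0"
      using g(1)[of j] by (simp add: SL_tuples_def)
    then show ?thesis
      by (metis singular_value_decomposition)
  qed
  then obtain K A H where KAH: "\<And>j m. unitary_matrix (K j m) \<and> unitary_matrix (H j m)
      \<and> diagonal_matrix (A j m) \<and> g j $ m = K j m ** A j m ** H j m"
    by metis
  define k a h where "k j = (\<chi> m. K j m)" and "a j = (\<chi> m. A j m)" and "h j = (\<chi> m. H j m)" for j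
  have u: "k j \<in> unitary_tuples" "h j \<in> unitary_tuples" and diag: "diagonal_matrix (a j $ m)" for j m
    using KAH by (auto simp: k_def a_def h_def unitary_tuples_def)
  have g_eq: "g j = (\<chi> m. k j $ m ** (\<chi> m. a j $ m ** h j $ m) $ m)" for j
    using KAH by (subst vec_eq_iff) (simp add: k_def a_def h_def matrix_mul_assoc)
  have x_eq: "x j = tensor_matrix (k j) *v (tensor_matrix (a j) *v (tensor_matrix (h j) *v v))" for j
    unfolding g(2) by (subst g_eq) (simp only: matrix_vector_mul_assoc tensor_matrix_mult)
  have "norm (x j) = norm (tensor_matrix (a j) *v (tensor_matrix (h j) *v v))" for j
    unfolding x_eq by (rule norm_unitary[OF unitary_tensor_matrix[OF u(1)]])
  with tendsto_norm_zero[OF x(2)]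
  have lim: "(\<lambda>j. tensor_matrix (a j) *v (tensor_matrix (h j) *v v)) \<longlonglongrightarrow> 0"
    by (simp add: tendsto_norm_zero_iff)
  have "\<forall>j. h j \<in> unitary_tuples"
    using u by simp
  then obtain h0 r where h0: "h0 \<in> unitary_tuples" and r: "strict_mono r" "(h \<circ> r) \<longlonglongrightarrow> h0"
    using compact_unitary_tuples[unfolded compact_def] by meson
  have "destabilized (tensor_matrix h0 *v v)"
  proof (rule destabilized_diagonal_limit[of "a \<circ> r"])
    show "diagonal_matrix ((a \<circ> r) j $ m)" for j m
      by (simp add: diag)
    show "cmod (det ((a \<circ> r) j $ m)) = 1" for j m
    proof -
      have "1 = det (g (r j) $ m)"
        using g(1)[of "r j"] by (simp add: SL_tuples_def)
      also have "\<dots> = det (K (r j) m) * det (A (r j) m) * det (H (r j) m)"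
        using KAH[of "r j" m] by (simp add: det_mul)
      finally have "1 = cmod (det (K (r j) m) * det (A (r j) m) * det (H (r j) m))"
        by simp
      then show ?thesis
        using KAH[of "r j" m] by (simp add: norm_mult cmod_det_unitary a_def)
    qed
    show "(\<lambda>j. tensor_matrix ((h \<circ> r) j) *v v) \<longlonglongrightarrow> tensor_matrix h0 *v v"
      by (intro tendsto_tensor_action r tendsto_const)
    show "(\<lambda>j. tensor_matrix ((a \<circ> r) j) *v (tensor_matrix ((h \<circ> r) j) *v v)) \<longlonglongrightarrow> 0"
      using LIMSEQ_subseq_LIMSEQ[OF lim r(1)] by (simp add: o_def)
  qed
  with h0 show thesis
    by (rule that)
qed

text \<open>The factor \<open>cnj (det (h $ k))\<close> in one diagonal entry restores determinant one; it changes
  absolute values of coordinates by a factor of modulus one only.\<close>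

lemma destabilizing_sequence:
  fixes v :: "('n::finite, 'd::finite) tensor"
  assumes h: "h \<in> unitary_tuples" and ds: "destabilized (tensor_matrix h *v v)"
  obtains g :: "nat \<Rightarrow> ('n, 'd) mat_tuple"
  where "\<And>j k. det (g j $ k) = 1" "\<And>j k. \<exists>D. diagonal_matrix D \<and> g j $ k = D ** h $ k"
    "(\<lambda>j. tensor_matrix (g j) *v v) \<longlonglongrightarrow> 0"
proof -
  obtain \<theta> :: "'d \<Rightarrow> 'n \<Rightarrow> real" where tr: "\<And>k. (\<Sum>i\<in>UNIV. \<theta> k i) = 0"
    and pos: "\<And>I. (tensor_matrix h *v v) $ I \<noteq> 0 \<Longrightarrow> (\<Sum>k\<in>UNIV. \<theta> k (I k)) > 0"
    using ds unfolding destabilized_def by blast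
  have hk: "unitary_matrix (h $ k)" for k
    using h by (simp add: unitary_tuples_def)
  fix i0 :: 'n
  define e where "e k i = (if i = i0 then cnj (det (h $ k)) else 1)" for k i
  have cmod_e: "cmod (e k i) = 1" for k i
    by (simp add: e_def cmod_det_unitary[OF hk])
  define a :: "nat \<Rightarrow> ('n, 'd) mat_tuple" where
    "a j = (\<chi> k i i'. if i = i' then e k i * of_real (exp (- real j * \<theta> k i)) else 0)" for j
  have diag: "diagonal_matrix (a j $ k)" for j k
    by (simp add: a_def diagonal_matrix_def)
  define g where "g j = (\<chi> k. a j $ k ** h $ k)" for j
  have det1: "det (g j $ k) = 1" for j k
  proof -
    have "det (a j $ k) = (\<Prod>i\<in>UNIV. e k i) * of_real (\<Prod>i\<in>UNIV. exp (- real j * \<theta> k i))"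
      unfolding det_diagonal_matrix[OF diag] by (simp add: a_def prod.distrib)
    also have "(\<Prod>i\<in>UNIV. exp (- real j * \<theta> k i)) = exp (\<Sum>i\<in>UNIV. - real j * \<theta> k i)"
      by (rule exp_sum[symmetric]) simp
    also have "(\<Sum>i\<in>UNIV. - real j * \<theta> k i) = 0"
      using tr[of k] by (simp add: sum_negf flip: sum_distrib_left)
    also have "(\<Prod>i\<in>UNIV. e k i) = cnj (det (h $ k))"
      by (simp add: e_def)
    finally have "det (g j $ k) = cnj (det (h $ k)) * det (h $ k)"
      by (simp add: g_def det_mul)
    also have "\<dots> = 1"
      using cmod_det_unitary[OF hk[of k]] complex_norm_square[of "det (h $ k)"]
      by (simp add: mult.commute)
    finally show ?thesis .
  qed
  have norm_eq: "cmod ((tensor_matrix (g j) *v v) $ I)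
      = exp (- (\<Sum>k\<in>UNIV. \<theta> k (I k))) ^ j * cmod ((tensor_matrix h *v v) $ I)" for j I
  proof -
    have eq: "tensor_matrix (g j) *v v = tensor_matrix (a j) *v (tensor_matrix h *v v)"
      by (simp add: g_def matrix_vector_mul_assoc tensor_matrix_mult)
    have "cmod ((tensor_matrix (g j) *v v) $ I)
        = (\<Prod>k\<in>UNIV. exp (- real j * \<theta> k (I k))) * cmod ((tensor_matrix h *v v) $ I)"
      unfolding eq tensor_matrix_diagonal_vec[OF diag]
      by (simp add: norm_mult a_def cmod_e flip: prod_norm)
    also have "(\<Prod>k\<in>UNIV. exp (- real j * \<theta> k (I k))) = exp (\<Sum>k\<in>UNIV. - real j * \<theta> k (I k))"
      by (rule exp_sum[symmetric]) simp
    also have "(\<Sum>k\<in>UNIV. - real j * \<theta> k (I k)) = real j * - (\<Sum>k\<in>UNIV. \<theta> k (I k))"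
      by (simp add: sum_distrib_left sum_negf)
    finally show ?thesis
      by (simp only: exp_of_nat_mult)
  qed
  have "(\<lambda>j. (tensor_matrix (g j) *v v) $ I) \<longlonglongrightarrow> 0" for I
  proof (cases "(tensor_matrix h *v v) $ I = 0")
    case True
    then have "(tensor_matrix (g j) *v v) $ I = 0" for j
      using norm_eq[of j I] by simp
    then show ?thesis
      by simp
  next
    case False
    then have "(\<lambda>j. exp (- (\<Sum>k\<in>UNIV. \<theta> k (I k))) ^ j) \<longlonglongrightarrow> 0"
      using pos[of I] by (intro LIMSEQ_power_zero) simp
    then have "(\<lambda>j. cmod ((tensor_matrix (g j) *v v) $ I)) \<longlonglongrightarrow> 0"
      unfolding norm_eq by (rule tendsto_mult_left_zero)
    then show ?thesis
      by (simp add: tendsto_norm_zero_iff)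
  qed
  then have "(\<lambda>j. tensor_matrix (g j) *v v) \<longlonglongrightarrow> 0"
    by (intro vec_tendstoI) simp
  moreover have "\<exists>D. diagonal_matrix D \<and> g j $ k = D ** h $ k" for j k
    using diag[of j k] by (auto simp: g_def)
  ultimately show thesis
    using det1 by (intro that[of g])
qed

text \<open>With the identity tuple for \<open>h\<close>, the factorisation supplied by
  \<open>destabilizing_sequence\<close> says that the sequence lies in the torus.\<close>

lemma unstable_ST_iff: "unstable ST_tuples v \<longleftrightarrow> destabilized v"
proof
  assume "destabilized v"
  then have "destabilized (tensor_matrix (\<chi> k. mat 1) *v v)"
    by (simp add: tensor_matrix_1)
  then obtain g where g: "\<And>j k. det (g j $ k) = 1"
    "\<And>j k. \<exists>D. diagonal_matrix D \<and> g j $ k = D ** (\<chi> k. mat 1) $ k"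
    "(\<lambda>j. tensor_matrix (g j) *v v) \<longlonglongrightarrow> 0"
    using destabilizing_sequence[of "\<chi> k. mat 1" v] unfolding unitary_tuples_def by auto
  then have "g j \<in> ST_tuples" for j
    by (auto simp: ST_tuples_def)
  with g(3) show "unstable ST_tuples v"
    unfolding unstable_def closure_sequential by (intro exI[of _ "\<lambda>j. tensor_matrix (g j) *v v"]) blast
qed (rule destabilized_if_unstable_ST)

lemma unstable_SL_iff:
  "unstable SL_tuples v \<longleftrightarrow> (\<exists>h\<in>unitary_tuples. destabilized (tensor_matrix h *v v))"
proof
  assume "\<exists>h\<in>unitary_tuples. destabilized (tensor_matrix h *v v)"
  then obtain h where "h \<in> unitary_tuples" "destabilized (tensor_matrix h *v v)" by blast
  then obtain g where g: "\<And>j k. det (g j $ k) = 1" "(\<lambda>j. tensor_matrix (g j) *v v) \<longlonglongrightarrow> 0"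
    by (rule destabilizing_sequence) blast
  then have "g j \<in> SL_tuples" for j
    by (auto simp: SL_tuples_def)
  with g(2) show "unstable SL_tuples v"
    unfolding unstable_def closure_sequential by (intro exI[of _ "\<lambda>j. tensor_matrix (g j) *v v"]) blast
qed (metis destabilized_if_unstable_SL)

lemma destabilized_imp_unstable_SL: "destabilized v \<Longrightarrow> unstable SL_tuples v"
  unfolding unstable_SL_iff
  by (rule bexI[of _ "\<chi> k. mat 1"]) (simp_all add: tensor_matrix_1 unitary_tuples_def)

section \<open>Attainment of the gap and of the weight margin\<close>

text \<open>The condition depends on the support alone and passes to smaller supports, so the set is
  a finite union of coordinate subspaces.\<close>

lemma closed_destabilized: "closed {v :: ('n::finite, 'd::finite) tensor. destabilized v}"
proof -
  define \<S> where "\<S> = {S. \<exists>\<theta> :: 'd \<Rightarrow> 'n \<Rightarrow> real. (\<forall>k. (\<Sum>i\<in>UNIV. \<theta> k i) = 0) \<and>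
     (\<forall>I\<in>S. (\<Sum>k\<in>UNIV. \<theta> k (I k)) > 0)}"
  have "{v :: ('n, 'd) tensor. destabilized v} = (\<Union>S\<in>\<S>. \<Inter>I\<in>-S. {v. v $ I = 0})"
  proof (intro set_eqI iffI)
    fix v :: "('n, 'd) tensor" assume "v \<in> {v. destabilized v}"
    then have "{I. v $ I \<noteq> 0} \<in> \<S>"
      by (auto simp: destabilized_def \<S>_def)
    then show "v \<in> (\<Union>S\<in>\<S>. \<Inter>I\<in>-S. {v. v $ I = 0})"
      by (rule UN_I) auto
  next
    fix v :: "('n, 'd) tensor" assume "v \<in> (\<Union>S\<in>\<S>. \<Inter>I\<in>-S. {v. v $ I = 0})"
    then obtain S where "S \<in> \<S>" "\<forall>I. I \<notin> S \<longrightarrow> v $ I = 0"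
      by auto
    then show "v \<in> {v. destabilized v}"
      unfolding destabilized_def \<S>_def mem_Collect_eq by metis
  qed
  moreover have "closed \<dots>"
    by (intro closed_UN closed_INT ballI closed_Collect_eq continuous_intros) simp
  ultimately show ?thesis
    by simp
qed

lemma closed_unstable_SL: "closed {v :: ('n::finite, 'd::finite) tensor. unstable SL_tuples v}"
  unfolding closed_sequential_limits
proof (intro allI impI, elim conjE)
  fix x :: "nat \<Rightarrow> ('n, 'd) tensor" and v
  assume x: "\<forall>j. x j \<in> {v. unstable SL_tuples v}" and lim: "x \<longlonglongrightarrow> v"
  then obtain h where h: "\<And>j. h j \<in> unitary_tuples" "\<And>j. destabilized (tensor_matrix (h j) *v x j)"
    unfolding unstable_SL_iff mem_Collect_eq by metis
  then obtain h0 r where h0: "h0 \<in> unitary_tuples" and r: "strict_mono r" "(h \<circ> r) \<longlonglongrightarrow> h0"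
    using compact_unitary_tuples[unfolded compact_def] by meson
  have "(\<lambda>j. tensor_matrix ((h \<circ> r) j) *v (x \<circ> r) j) \<longlonglongrightarrow> tensor_matrix h0 *v v"
    by (intro tendsto_tensor_action r LIMSEQ_subseq_LIMSEQ lim)
  then have "tensor_matrix h0 *v v \<in> {v. destabilized v}"
    by (rule closed_sequentially[OF closed_destabilized, rotated]) (simp add: h)
  with h0 show "v \<in> {v. unstable SL_tuples v}"
    unfolding unstable_SL_iff by blast
qed

lemma moment_G_scaleR:
  fixes v :: "('n::finite, 'd::finite) tensor"
  assumes "c \<noteq> 0" "v \<noteq> 0" shows "moment_G (c *\<^sub>R v) = moment_G v"
proof -
  have "reduced (c *\<^sub>R v) k $ i $ j = of_real (c * c) * reduced v k $ i $ j" for k i j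
    unfolding reduced_def vec_lambda_beta sum_distrib_left
    by (intro sum.cong refl) (simp add: scaleR_conv_of_real[where 'a = complex] mult_ac)
  moreover have "hinner (c *\<^sub>R v) (c *\<^sub>R v) = of_real (c * c) * hinner v v"
    by (simp add: hinner_def sum_distrib_left scaleR_conv_of_real[where 'a = complex] mult_ac)
  ultimately have "moment_formula (c *\<^sub>R v) = moment_formula v"
    using assms by (simp add: moment_formula_def)
  then show ?thesis
    using assms by (simp add: moment_G_eq)
qed

lemma moment_T_scaleR:
  "c \<noteq> 0 \<Longrightarrow> v \<noteq> 0 \<Longrightarrow> moment_T (c *\<^sub>R v) = moment_T v"
  by (simp add: moment_T_eq moment_G_scaleR)

lemma destabilized_scaleR: "destabilized v \<Longrightarrow> destabilized (c *\<^sub>R v)"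
  unfolding destabilized_def by (metis scaleR_eq_0_iff vector_scaleR_component)

lemma unstable_SL_scaleR:
  fixes v :: "('n::finite, 'd::finite) tensor"
  shows "unstable SL_tuples v \<Longrightarrow> unstable SL_tuples (c *\<^sub>R v)"
proof -
  have "A *v (c *\<^sub>R w) = c *\<^sub>R (A *v w)" for A :: "complex ^ ('d \<Rightarrow> 'n) ^ ('d \<Rightarrow> 'n)" and w
    by (simp add: vec_eq_iff matrix_vector_mult_def scaleR_sum_right)
  then show "unstable SL_tuples v \<Longrightarrow> unstable SL_tuples (c *\<^sub>R v)"
    unfolding unstable_SL_iff by (metis destabilized_scaleR)
qed

text \<open>By scale invariance all values on nonzero vectors of the cone occur on its intersection
  with the unit sphere, which is compact. This is also what gives the \<open>LEAST\<close> in the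
  definitions its meaning.\<close>

lemma least_attained_on_cone:
  fixes f :: "'a::euclidean_space \<Rightarrow> 'b::real_normed_vector"
  assumes clo: "closed N" and scale: "\<And>c v. v \<in> N \<Longrightarrow> c *\<^sub>R v \<in> N"
    and ex: "v1 \<in> N" "v1 \<noteq> 0"
    and cont: "continuous_on {v. v \<noteq> 0} f"
    and inv: "\<And>c v. c \<noteq> 0 \<Longrightarrow> v \<noteq> 0 \<Longrightarrow> f (c *\<^sub>R v) = f v"
  defines "m \<equiv> LEAST x. x \<in> {norm (f v) |v. v \<noteq> 0 \<and> v \<in> N}"
  shows "\<exists>v\<in>N. v \<noteq> 0 \<and> m = norm (f v)" "\<And>v. v \<in> N \<Longrightarrow> v \<noteq> 0 \<Longrightarrow> m \<le> norm (f v)"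
proof -
  let ?S = "N \<inter> sphere 0 1"
  have nrm: "v /\<^sub>R norm v \<in> ?S" if "v \<in> N" "v \<noteq> 0" for v
    using that scale by simp
  have "compact ?S"
    by (intro closed_Int_compact clo compact_sphere)
  moreover have "?S \<noteq> {}"
    using nrm[OF ex] by blast
  moreover have "continuous_on ?S (\<lambda>v. norm (f v))"
    by (intro continuous_on_norm continuous_on_subset[OF cont]) auto
  ultimately obtain v0 where v0: "v0 \<in> ?S" "\<And>v. v \<in> ?S \<Longrightarrow> norm (f v0) \<le> norm (f v)"
    using continuous_attains_inf by metis
  have min: "norm (f v0) \<le> norm (f v)" if "v \<in> N" "v \<noteq> 0" for v
    using v0(2)[OF nrm[OF that]] inv[of "inverse (norm v)" v] that by simp
  have v0': "v0 \<in> N" "v0 \<noteq> 0"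
    using v0(1) by auto
  have "m = norm (f v0)"
    unfolding m_def using v0' min by (intro Least_equality) auto
  with v0' min show "\<exists>v\<in>N. v \<noteq> 0 \<and> m = norm (f v)" "\<And>v. v \<in> N \<Longrightarrow> v \<noteq> 0 \<Longrightarrow> m \<le> norm (f v)"
    by auto
qed

lemma
  fixes v1 :: "('n::finite, 'd::finite) tensor"
  assumes "unstable SL_tuples v1" "v1 \<noteq> 0"
  shows gap_attained: "\<exists>v :: ('n, 'd) tensor. unstable SL_tuples v \<and> v \<noteq> 0 \<and>
      gap TYPE('n) TYPE('d) = norm (moment_G v)"
    and gap_le: "gap TYPE('n) TYPE('d) \<le> norm (moment_G v1)"
  using least_attained_on_cone[OF closed_unstable_SL _ _ _ continuous_on_moment_G moment_G_scaleR, of v1]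
    unstable_SL_scaleR assms
  unfolding gap_def mem_Collect_eq by blast+

lemma weight_margin_le:
  fixes v1 :: "('n::finite, 'd::finite) tensor"
  assumes "destabilized v1" "v1 \<noteq> 0"
  shows "weight_margin TYPE('n) TYPE('d) \<le> norm (moment_T v1)"
  using least_attained_on_cone(2)[OF closed_destabilized _ _ _ continuous_on_moment_T moment_T_scaleR, of v1]
    destabilized_scaleR assms
  unfolding weight_margin_def unstable_ST_iff mem_Collect_eq by blast

text \<open>A minimiser for the full group need not be unstable under the torus. A unitary translate
  of it is, and the translation preserves the norm of the moment map.\<close>

lemma weight_margin_le_gap:
  fixes v1 :: "('n::finite, 'd::finite) tensor"
  assumes "unstable SL_tuples v1" "v1 \<noteq> 0"
  shows "weight_margin TYPE('n) TYPE('d) \<le> gap TYPE('n) TYPE('d)"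
proof -
  obtain v :: "('n, 'd) tensor" where v: "unstable SL_tuples v" "v \<noteq> 0"
    and gap: "gap TYPE('n) TYPE('d) = norm (moment_G v)"
    using gap_attained[OF assms] by blast
  obtain h where h: "h \<in> unitary_tuples" "destabilized (tensor_matrix h *v v)"
    using v(1) by (rule destabilized_if_unstable_SL)
  let ?w = "tensor_matrix h *v v"
  have "norm ?w = norm v"
    by (rule norm_unitary[OF unitary_tensor_matrix[OF h(1)]])
  then have w: "?w \<noteq> 0"
    using v(2) by (metis norm_eq_zero)
  have "weight_margin TYPE('n) TYPE('d) \<le> norm (moment_T ?w)"
    by (rule weight_margin_le[OF h(2) w])
  also have "\<dots> \<le> norm (moment_G ?w)"
    by (simp add: moment_T_eq[OF w] norm_diag_part_le)
  also have "\<dots> = gap TYPE('n) TYPE('d)"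
    by (simp add: gap norm_moment_G_unitary[OF h(1) v(2)])
  finally show ?thesis .
qed

section \<open>Vectors with diagonal moment map\<close>

text \<open>An off-diagonal entry of a reduced matrix sums products of coordinates whose
  multi-indices differ in exactly one place; \<open>sep\<close> makes all of them vanish, so only
  the marginals of \<open>C\<close> survive.\<close>

lemma norm_moment_G_sqrt:
  fixes C :: "('d::finite \<Rightarrow> 'n::finite) \<Rightarrow> real"
  assumes nonneg: "\<And>I. C I \<ge> 0" and sum1: "(\<Sum>I\<in>UNIV. C I) = 1"
    and sep: "\<And>I k i. C I \<noteq> 0 \<Longrightarrow> C (I(k := i)) \<noteq> 0 \<Longrightarrow> I k = i"
  defines "v \<equiv> (\<chi> I. of_real (sqrt (C I))) :: ('n, 'd) tensor"
  shows "v \<noteq> 0"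
    and "norm (moment_G v) = sqrt (\<Sum>k\<in>UNIV. \<Sum>i\<in>UNIV. ((\<Sum>I | I k = i. C I) - 1 / real CARD('n))\<^sup>2)"
proof -
  have self: "cnj (v $ I) * v $ I = of_real (C I)" for I
    using nonneg[of I] by (simp add: v_def flip: of_real_mult)
  have vv: "hinner v v = 1"
    by (simp add: hinner_def self sum1 flip: of_real_sum)
  then show nz: "v \<noteq> 0"
    by (auto simp: hinner_def)
  have red: "reduced v k $ i $ j = (if i = j then of_real (\<Sum>I | I k = i. C I) else 0)" for k i j
  proof (cases "i = j")
    case True
    have "reduced v k $ i $ j = (\<Sum>I | I k = j. of_real (C I))"
      unfolding reduced_def vec_lambda_beta using True by (intro sum.cong) (auto simp flip: self)
    with True show ?thesis
      by simp
  next
    case False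
    have "cnj (v $ I) * v $ (I(k := i)) = 0" if "I k = j" for I
      using sep[of I k i] False that by (auto simp: v_def)
    then have "reduced v k $ i $ j = 0"
      unfolding reduced_def vec_lambda_beta by (intro sum.neutral) blast
    with False show ?thesis
      by simp
  qed
  have "(cmod (moment_G v $ k $ i $ j))\<^sup>2
      = (if j = i then ((\<Sum>I | I k = i. C I) - 1 / real CARD('n))\<^sup>2 else 0)" for k i j
  proof -
    have "moment_G v $ k $ i $ j
        = of_real (if i = j then (\<Sum>I | I k = i. C I) - 1 / real CARD('n) else 0)"
      by (simp add: moment_G_eq[OF nz] moment_formula_def red vv)
    then show ?thesis
      by simp
  qed
  then show "norm (moment_G v)
      = sqrt (\<Sum>k\<in>UNIV. \<Sum>i\<in>UNIV. ((\<Sum>I | I k = i. C I) - 1 / real CARD('n))\<^sup>2)"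
    by (simp add: norm_mat_tuple_eq_frobenius)
qed

section \<open>Weighted sets of multi-indices\<close>

text \<open>Multi-indices are written as lists of length \<open>d\<close> with entries below \<open>n\<close>, so that blocks of
  tensor factors can be concatenated.\<close>

definition states :: "nat \<Rightarrow> nat \<Rightarrow> nat list set" where
  "states n d = {xs. length xs = d \<and> set xs \<subseteq> {..<n}}"

text \<open>Distinct members differ in at least two places, which makes the moment map diagonal.\<close>

definition separated :: "nat list set \<Rightarrow> bool" where
  "separated S \<longleftrightarrow> (\<forall>x\<in>S. \<forall>y\<in>S. \<forall>k. x[k := 0] = y[k := 0] \<longrightarrow> x = y)"

definition weight :: "(nat \<Rightarrow> real) list \<Rightarrow> nat list \<Rightarrow> real" where
  "weight \<theta> xs = sum_list (map2 (\<lambda>t i. t i) \<theta> xs)"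

definition marginal :: "nat list set \<Rightarrow> (nat list \<Rightarrow> real) \<Rightarrow> nat \<Rightarrow> nat \<Rightarrow> real" where
  "marginal S c k i = (\<Sum>x\<in>S. if x ! k = i then c x else 0)"

definition traceless :: "nat \<Rightarrow> (nat \<Rightarrow> real) list \<Rightarrow> bool" where
  "traceless n \<theta> \<longleftrightarrow> (\<forall>t\<in>set \<theta>. (\<Sum>i<n. t i) = 0)"

text \<open>The total mass of \<open>c\<close> is left open: it is one in a tail block and
  \<open>1 - \<epsilon>\<close> in a head block.\<close>

definition unstable_design ::
  "nat \<Rightarrow> nat \<Rightarrow> (nat \<Rightarrow> real) list \<Rightarrow> nat list set \<Rightarrow> (nat list \<Rightarrow> real) \<Rightarrow> bool" where
  "unstable_design n d \<theta> S c \<longleftrightarrow> S \<subseteq> states n d \<and> separated S \<and> (\<forall>x\<in>S. c x \<ge> 0) \<and>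
     length \<theta> = d \<and> traceless n \<theta> \<and> (\<forall>x\<in>S. weight \<theta> x > 0)"

text \<open>The uniform weight on a neutral family has uniform marginals, so that it can fill up a block
  of tensor factors without contributing to the moment map or to the weights.\<close>

definition neutral_family :: "nat \<Rightarrow> nat \<Rightarrow> (nat \<Rightarrow> real) list \<Rightarrow> (nat \<Rightarrow> nat list) \<Rightarrow> bool" where
  "neutral_family n d \<theta> F \<longleftrightarrow> (\<forall>i<n. F i \<in> states n d \<and> weight \<theta> (F i) = 0) \<and>
     (\<forall>k<d. bij_betw (\<lambda>i. F i ! k) {..<n} {..<n}) \<and>
     (\<forall>i<n. \<forall>j<n. \<forall>k. (F i)[k := 0] = (F j)[k := 0] \<longrightarrow> i = j)"

text \<open>The number \<eta> bounds the norm of the moment map. The flag \<open>b\<close> records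
  that a neutral family exists for the same \<theta>, as is required for attaching the block to a
  head.\<close>

definition tail_block :: "nat \<Rightarrow> nat \<Rightarrow> real \<Rightarrow> bool \<Rightarrow> bool" where
  "tail_block n d \<eta> b \<longleftrightarrow> (\<exists>S c \<theta>. unstable_design n d \<theta> S c \<and> sum c S = 1 \<and>
     (\<Sum>k<d. \<Sum>i<n. (marginal S c k i - 1 / real n)\<^sup>2) \<le> \<eta>\<^sup>2 \<and> (b \<longrightarrow> (\<exists>F. neutral_family n d \<theta> F)))"

text \<open>In a head block the mass \<open>\<epsilon>\<close> that is missing for uniform marginals sits at a single
  state \<open>z\<close>; there a further block can be attached.\<close>

definition head_block :: "nat \<Rightarrow> nat \<Rightarrow> real \<Rightarrow> bool \<Rightarrow> bool" where
  "head_block n d \<epsilon> b \<longleftrightarrow> (\<exists>S c \<theta> z. unstable_design n d \<theta> S c \<and> z \<in> states n d \<and> z \<notin> S \<and>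
     separated (insert z S) \<and> 0 \<le> \<epsilon> \<and> sum c S = 1 - \<epsilon> \<and>
     (\<forall>k<d. \<forall>i<n. marginal S c k i + (if z ! k = i then \<epsilon> else 0) = 1 / real n) \<and>
     (b \<longrightarrow> (\<exists>F. neutral_family n d \<theta> F)))"

lemma finite_states: "finite (states n d)"
proof -
  have "states n d = {xs. set xs \<subseteq> {..<n} \<and> length xs = d}"
    by (auto simp: states_def)
  then show ?thesis
    by (simp add: finite_lists_length_eq)
qed

lemma weight_nth: "length \<theta> = length xs \<Longrightarrow> weight \<theta> xs = (\<Sum>k<length xs. (\<theta> ! k) (xs ! k))"
  by (simp add: weight_def sum_list_sum_nth atLeast0LessThan)

lemma weight_append:
  "length \<theta> = length xs \<Longrightarrow> weight (\<theta> @ \<phi>) (xs @ ys) = weight \<theta> xs + weight \<phi> ys"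
  by (simp add: weight_def)

lemma weight_scale: "weight (map (\<lambda>t i. \<delta> * t i) \<theta>) xs = \<delta> * weight \<theta> xs"
proof (induction \<theta> arbitrary: xs)
  case (Cons t \<theta>)
  then show ?case
    by (cases xs) (auto simp: weight_def distrib_left)
qed (simp add: weight_def)

lemma traceless_scale: "traceless n \<theta> \<Longrightarrow> traceless n (map (\<lambda>t i. \<delta> * t i) \<theta>)"
  by (auto simp: traceless_def simp flip: sum_distrib_left)

text \<open>Enumerations of the two index types identify multi-indices with lists; the coordinates
  of the tensor are the square roots of the masses.\<close>

theorem tensor_of_tail_block:
  assumes "tail_block CARD('n) CARD('d) \<eta> b" and \<eta>: "\<eta> \<ge> 0"
  obtains v :: "('n::finite, 'd::finite) tensor"
  where "v \<noteq> 0" "destabilized v" "norm (moment_G v) \<le> \<eta>"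
proof -
  let ?n = "CARD('n)" and ?d = "CARD('d)"
  obtain S c \<theta> where des: "unstable_design ?n ?d \<theta> S c" and sum_c: "sum c S = 1"
    and err: "(\<Sum>k<?d. \<Sum>i<?n. (marginal S c k i - 1 / real ?n)\<^sup>2) \<le> \<eta>\<^sup>2"
    using assms(1) unfolding tail_block_def by blast
  from des have S: "S \<subseteq> states ?n ?d" and sep: "separated S" and nonneg: "\<And>x. x \<in> S \<Longrightarrow> c x \<ge> 0"
    and len: "length \<theta> = ?d" and tr: "traceless ?n \<theta>" and pos: "\<And>x. x \<in> S \<Longrightarrow> weight \<theta> x > 0"
    by (auto simp: unstable_design_def)
  obtain e :: "'n \<Rightarrow> nat" where e: "bij_betw e UNIV {..<?n}"
    using ex_bij_betw_finite_nat[of "UNIV :: 'n set"] by (auto simp: atLeast0LessThan)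
  obtain f :: "'d \<Rightarrow> nat" where f: "bij_betw f UNIV {..<?d}"
    using ex_bij_betw_finite_nat[of "UNIV :: 'd set"] by (auto simp: atLeast0LessThan)
  have f_lt: "f k < ?d" and e_lt: "e i < ?n" for k i
    using bij_betwE[OF f] bij_betwE[OF e] by auto
  have inv_f: "inv f (f k) = k" and inj_f: "f k = f l \<longleftrightarrow> k = l" for k l
    using f by (auto simp: bij_betw_def inj_eq)
  have inj_e: "e i = e j \<longleftrightarrow> i = j" for i j
    using e by (auto simp: bij_betw_def inj_eq)
  have f_inv: "\<exists>k'. f k' = k \<and> inv f k = k'" if "k < ?d" for k
    using f that inv_f unfolding bij_betw_def by (metis image_iff lessThan_iff)
  define L where "L I = map (\<lambda>k. e (I (inv f k))) [0..<?d]" for I :: "'d \<Rightarrow> 'n"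
  have L_len: "length (L I) = ?d" and L_nth: "L I ! f k = e (I k)" for I k
    using f_lt[of k] by (auto simp: L_def inv_f)
  have eqI: "x = y" if "length x = ?d" "length y = ?d" "\<And>k. x ! f k = y ! f k" for x y :: "nat list"
  proof (rule nth_equalityI)
    fix k assume "k < length x"
    then show "x ! k = y ! k"
      using f_inv[of k] that by metis
  qed (simp add: that)
  have inj_L: "L I = L J \<longleftrightarrow> I = J" for I J
    using L_nth inj_e by (metis ext)
  have bij_L: "bij_betw L UNIV (states ?n ?d)"
    unfolding bij_betw_def
  proof (intro conjI set_eqI iffI)
    show "inj L"
      by (simp add: inj_def inj_L)
    show "x \<in> states ?n ?d" if "x \<in> range L" for x
      using that e_lt by (auto simp: states_def L_def)
    show "x \<in> range L" if x: "x \<in> states ?n ?d" for x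
    proof -
      have "x ! f k < ?n" for k
        using x f_lt[of k] by (auto simp: states_def subset_iff)
      then have "e (inv e (x ! f k)) = x ! f k" for k
        using e by (auto simp: bij_betw_def f_inv_into_f)
      then have "L (\<lambda>k. inv e (x ! f k)) = x"
        using x by (intro eqI) (auto simp: L_len L_nth states_def)
      then show ?thesis
        by (metis rangeI)
    qed
  qed
  define C where "C I = (if L I \<in> S then c (L I) else 0)" for I
  have sum_L: "(\<Sum>I\<in>UNIV. if L I \<in> S then g (L I) else 0) = sum g S" for g :: "nat list \<Rightarrow> real"
  proof -
    have "(\<Sum>I\<in>UNIV. if L I \<in> S then g (L I) else 0) = (\<Sum>x\<in>states ?n ?d. if x \<in> S then g x else 0)"
      by (rule sum.reindex_bij_betw[OF bij_L])
    also have "\<dots> = sum g (states ?n ?d \<inter> S)"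
      by (rule sum.inter_restrict[symmetric]) (rule finite_states)
    also have "states ?n ?d \<inter> S = S"
      using S by blast
    finally show ?thesis .
  qed
  have C_nonneg: "C I \<ge> 0" for I
    using nonneg by (simp add: C_def)
  have C_sum: "(\<Sum>I\<in>UNIV. C I) = 1"
    unfolding C_def sum_L by (rule sum_c)
  have C_sep: "I k = i" if "C I \<noteq> 0" "C (I(k := i)) \<noteq> 0" for I k i
  proof -
    have "L (I(k := i)) = (L I)[f k := e i]"
      using f_lt[of k]
      by (intro eqI) (auto simp: L_len L_nth nth_list_update inj_f)
    then have "(L (I(k := i)))[f k := 0] = (L I)[f k := 0]"
      by simp
    moreover have "L I \<in> S" "L (I(k := i)) \<in> S"
      using that by (auto simp: C_def split: if_splits)
    ultimately have "L (I(k := i)) = L I"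
      using sep unfolding separated_def by blast
    then show ?thesis
      unfolding inj_L by (metis fun_upd_same)
  qed
  define v :: "('n, 'd) tensor" where "v = (\<chi> I. of_real (sqrt (C I)))"
  have v_nz: "v \<noteq> 0"
    unfolding v_def by (rule norm_moment_G_sqrt(1); (rule C_nonneg C_sum C_sep; assumption)?)
  have v_norm: "norm (moment_G v)
      = sqrt (\<Sum>k\<in>UNIV. \<Sum>i\<in>UNIV. ((\<Sum>I | I k = i. C I) - 1 / real CARD('n))\<^sup>2)"
    unfolding v_def by (rule norm_moment_G_sqrt(2); (rule C_nonneg C_sum C_sep; assumption)?)
  have marg: "(\<Sum>I | I k = i. C I) = marginal S c (f k) (e i)" for k i
  proof -
    have "(\<Sum>I | I k = i. C I) = (\<Sum>I\<in>UNIV. if I k = i then C I else 0)"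
      by (simp add: sum.If_cases)
    also have "\<dots> = (\<Sum>I\<in>UNIV. if L I \<in> S then (if L I ! f k = e i then c (L I) else 0) else 0)"
      by (intro sum.cong) (auto simp: C_def L_nth inj_e)
    also have "\<dots> = marginal S c (f k) (e i)"
      unfolding marginal_def by (rule sum_L)
    finally show ?thesis .
  qed
  have "(\<Sum>k\<in>UNIV. \<Sum>i\<in>UNIV. ((\<Sum>I | I k = i. C I) - 1 / real ?n)\<^sup>2)
      = (\<Sum>k<?d. \<Sum>i<?n. (marginal S c k i - 1 / real ?n)\<^sup>2)"
    unfolding marg sum.reindex_bij_betw[OF e, of "\<lambda>i. (marginal S c _ i - 1 / real ?n)\<^sup>2"]
    by (rule sum.reindex_bij_betw[OF f])
  then have "norm (moment_G v) \<le> \<eta>"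
    unfolding v_norm using err \<eta> by (simp add: real_le_lsqrt)
  moreover have "destabilized v"
    unfolding destabilized_def
  proof (intro exI[of _ "\<lambda>k i. (\<theta> ! f k) (e i)"] conjI allI impI)
    fix k
    show "(\<Sum>i\<in>UNIV. (\<theta> ! f k) (e i)) = 0"
      using tr f_lt[of k] len by (simp add: sum.reindex_bij_betw[OF e] traceless_def)
  next
    fix I assume "v $ I \<noteq> 0"
    then have "L I \<in> S"
      by (auto simp: v_def C_def split: if_splits)
    then have "0 < weight \<theta> (L I)"
      by (rule pos)
    also have "\<dots> = (\<Sum>k<?d. (\<theta> ! k) (L I ! k))"
      by (simp add: weight_nth len L_len)
    also have "\<dots> = (\<Sum>k\<in>UNIV. (\<theta> ! f k) (L I ! f k))"
      by (rule sum.reindex_bij_betw[OF f, symmetric])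
    finally show "0 < (\<Sum>k\<in>UNIV. (\<theta> ! f k) (e (I k)))"
      by (simp add: L_nth)
  qed
  ultimately show thesis
    using v_nz that by blast
qed

section \<open>Concatenating, doubling and normalising blocks\<close>

lemma sum_lessThan_add:
  fixes f :: "nat \<Rightarrow> 'a::comm_monoid_add"
  shows "(\<Sum>k<m + n. f k) = (\<Sum>k<m. f k) + (\<Sum>k<n. f (m + k))"
  by (induction n) (auto simp: add.assoc)

lemma sum_bij_indicator:
  fixes a :: real and n :: nat
  assumes "bij_betw \<sigma> {..<n} {..<n}" "i < n"
  shows "(\<Sum>j<n. if \<sigma> j = i then a else 0) = a"
proof -
  have "(\<Sum>j<n. if \<sigma> j = i then a else 0) = (\<Sum>j<n. if j = i then a else 0)"
    by (rule sum.reindex_bij_betw[OF assms(1)])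
  with assms(2) show ?thesis
    by simp
qed

lemma neutral_familyD:
  assumes "neutral_family n d \<theta> F" "i < n"
  shows "length (F i) = d" "set (F i) \<subseteq> {..<n}" "weight \<theta> (F i) = 0"
    "\<And>k. k < d \<Longrightarrow> bij_betw (\<lambda>i. F i ! k) {..<n} {..<n}"
    "\<And>j k. j < n \<Longrightarrow> (F i)[k := 0] = (F j)[k := 0] \<Longrightarrow> i = j"
    "\<And>j. j < n \<Longrightarrow> F i = F j \<Longrightarrow> i = j"
  using assms unfolding neutral_family_def states_def by auto metis

text \<open>Scaling keeps zero weights zero. A change in one place leaves one of the two halves
  intact, and either half determines the index. Through this lemma a composite block can itself be
  attached again.\<close>

lemma neutral_family_append:
  assumes F: "neutral_family n d \<theta> F" and G: "neutral_family n m \<phi> G"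
    and len: "length \<theta> = d"
  shows "neutral_family n (d + m) (map (\<lambda>t i. \<delta> * t i) \<theta> @ \<phi>) (\<lambda>i. F i @ G i)"
  unfolding neutral_family_def
proof (intro conjI allI impI)
  fix i assume i: "i < n"
  note Fi = neutral_familyD[OF F i] and Gi = neutral_familyD[OF G i]
  show "F i @ G i \<in> states n (d + m)"
    using Fi(1,2) Gi(1,2) by (simp add: states_def)
  show "weight (map (\<lambda>t i. \<delta> * t i) \<theta> @ \<phi>) (F i @ G i) = 0"
    using Fi(1,3) Gi(3) by (simp add: weight_append len weight_scale)
  fix j k assume j: "j < n" and eq: "(F i @ G i)[k := 0] = (F j @ G j)[k := 0]"
  show "i = j"
    using eq Fi(1) Fi(6)[OF j] Gi(6)[OF j] neutral_familyD(1)[OF F j]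
    by (auto simp: list_update_append split: if_splits)
next
  fix k assume k: "k < d + m"
  show "bij_betw (\<lambda>i. (F i @ G i) ! k) {..<n} {..<n}"
  proof (cases "k < d")
    case True
    then have "bij_betw (\<lambda>i. F i ! k) {..<n} {..<n}"
      using F by (simp add: neutral_family_def)
    then show ?thesis
      by (rule bij_betw_cong[THEN iffD1, rotated]) (use True F in \<open>auto simp: nth_append neutral_familyD\<close>)
  next
    case False
    then have "bij_betw (\<lambda>i. G i ! (k - d)) {..<n} {..<n}"
      using G k by (simp add: neutral_family_def)
    then show ?thesis
      by (rule bij_betw_cong[THEN iffD1, rotated]) (use False F in \<open>auto simp: nth_append neutral_familyD\<close>)
  qed
qed

text \<open>Each state of the head block is continued by the neutral family of the tail block, and the
  exceptional state of the head block by the tail block itself. The weights of the head block are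
  scaled down so much that they do not spoil the positivity on the latter states.\<close>

theorem tail_block_append:
  assumes head: "head_block n d \<epsilon> b" and tail: "tail_block n m \<eta> True" and n: "n > 0"
  shows "tail_block n (d + m) (\<epsilon> * \<eta>) b"
proof -
  obtain A a \<theta>\<^sub>1 z where des1: "unstable_design n d \<theta>\<^sub>1 A a" and z: "z \<in> states n d" "z \<notin> A"
    and sep1: "separated (insert z A)" and \<epsilon>: "0 \<le> \<epsilon>" and sum_a: "sum a A = 1 - \<epsilon>"
    and marg1: "\<And>k i. k < d \<Longrightarrow> i < n \<Longrightarrow> marginal A a k i + (if z ! k = i then \<epsilon> else 0) = 1 / real n"
    and fam1: "b \<Longrightarrow> \<exists>F. neutral_family n d \<theta>\<^sub>1 F"
    using head unfolding head_block_def by blast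
  obtain S c \<theta>\<^sub>2 F where des2: "unstable_design n m \<theta>\<^sub>2 S c" and sum_c: "sum c S = 1"
    and err: "(\<Sum>k<m. \<Sum>i<n. (marginal S c k i - 1 / real n)\<^sup>2) \<le> \<eta>\<^sup>2"
    and F: "neutral_family n m \<theta>\<^sub>2 F"
    using tail unfolding tail_block_def by blast
  have A: "finite A" "\<And>x. x \<in> A \<Longrightarrow> length x = d" "\<And>x. x \<in> A \<Longrightarrow> set x \<subseteq> {..<n}"
    "\<And>x. x \<in> A \<Longrightarrow> a x \<ge> 0" "length \<theta>\<^sub>1 = d" "traceless n \<theta>\<^sub>1" "\<And>x. x \<in> A \<Longrightarrow> weight \<theta>\<^sub>1 x > 0"
    using des1 finite_subset[OF _ finite_states] by (auto simp: unstable_design_def states_def)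
  have S: "finite S" "\<And>x. x \<in> S \<Longrightarrow> length x = m" "\<And>x. x \<in> S \<Longrightarrow> set x \<subseteq> {..<n}"
    "\<And>x. x \<in> S \<Longrightarrow> c x \<ge> 0" "length \<theta>\<^sub>2 = m" "traceless n \<theta>\<^sub>2" "\<And>x. x \<in> S \<Longrightarrow> weight \<theta>\<^sub>2 x > 0"
    "separated S"
    using des2 finite_subset[OF _ finite_states] by (auto simp: unstable_design_def states_def)
  have z_len: "length z = d" "set z \<subseteq> {..<n}"
    using z by (auto simp: states_def)
  define P Q where "P = (\<lambda>(x, i). x @ F i) ` (A \<times> {..<n})" and "Q = (\<lambda>y. z @ y) ` S"
  \<comment> \<open>The first \<open>d\<close> entries tell the cases apart because \<open>z\<close>
    is not in \<open>A\<close>. The mass of a head state is split evenly among its \<open>n\<close>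
    continuations; the tail receives the mass \<epsilon> missing at \<open>z\<close>.\<close>
  define c' where "c' w = (if take d w = z then \<epsilon> * c (drop d w) else a (take d w) / real n)" for w
  have xz: "x \<noteq> z" if "x \<in> A" for x
    using that z by blast
  have c'_P: "c' (x @ u) = a x / real n" if "x \<in> A" for x u
    using xz[OF that] A(2)[OF that] by (simp add: c'_def)
  have c'_Q: "c' (z @ y) = \<epsilon> * c y" for y
    by (simp add: c'_def z_len)
  have injP: "inj_on (\<lambda>(x, i). x @ F i) (A \<times> {..<n})"
    using A(2) neutral_familyD(6)[OF F] by (auto simp: inj_on_def)
  have injQ: "inj_on (\<lambda>y. z @ y) S"
    by (simp add: inj_on_def)
  have disj: "P \<inter> Q = {}"
    using A(2) z_len xz by (auto simp: P_def Q_def)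
  have finP: "finite P" "finite Q"
    using A(1) S(1) by (auto simp: P_def Q_def)
  have sum_PQ: "sum g (P \<union> Q) = (\<Sum>x\<in>A. \<Sum>i<n. g (x @ F i)) + (\<Sum>y\<in>S. g (z @ y))"
    for g :: "nat list \<Rightarrow> real"
  proof -
    have "sum g P = (\<Sum>(x, i)\<in>A \<times> {..<n}. g (x @ F i))"
      unfolding P_def by (subst sum.reindex[OF injP]) (simp add: o_def case_prod_unfold)
    also have "\<dots> = (\<Sum>x\<in>A. \<Sum>i<n. g (x @ F i))"
      by (simp add: sum.cartesian_product)
    finally have "sum g P = (\<Sum>x\<in>A. \<Sum>i<n. g (x @ F i))" .
    moreover have "sum g Q = (\<Sum>y\<in>S. g (z @ y))"
      unfolding Q_def by (subst sum.reindex[OF injQ]) (simp add: o_def)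
    ultimately show ?thesis
      by (simp add: sum.union_disjoint[OF finP disj])
  qed
  have sum_c': "sum c' (P \<union> Q) = 1"
    unfolding sum_PQ c'_Q using n by (simp add: c'_P sum_a sum_c flip: sum_distrib_left)
  have marg_head: "marginal (P \<union> Q) c' k i = 1 / real n" if "k < d" "i < n" for k i
  proof -
    have "marginal (P \<union> Q) c' k i = (\<Sum>x\<in>A. \<Sum>j<n. if x ! k = i then a x / real n else 0)
        + (\<Sum>y\<in>S. if z ! k = i then \<epsilon> * c y else 0)"
      unfolding marginal_def sum_PQ c'_Q using that A(2) z_len
      by (simp add: c'_P nth_append cong: sum.cong if_cong)
    also have "(\<Sum>x\<in>A. \<Sum>j<n. if x ! k = i then a x / real n else 0) = marginal A a k i"
      unfolding marginal_def using n by (intro sum.cong) auto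
    also have "(\<Sum>y\<in>S. if z ! k = i then \<epsilon> * c y else 0) = (if z ! k = i then \<epsilon> else 0)"
      using sum_c by (auto simp flip: sum_distrib_left)
    finally show ?thesis
      using marg1[OF that] by simp
  qed
  \<comment> \<open>In a tail factor the head mass \<open>1 - \<epsilon>\<close> is spread uniformly
    by \<open>F\<close>, so the whole deviation stems from \<epsilon> times the tail
    marginal.\<close>
  have marg_tail: "marginal (P \<union> Q) c' (d + k) i - 1 / real n = \<epsilon> * (marginal S c k i - 1 / real n)"
    if "k < m" "i < n" for k i
  proof -
    have "marginal (P \<union> Q) c' (d + k) i = (\<Sum>x\<in>A. \<Sum>j<n. if F j ! k = i then a x / real n else 0)
        + (\<Sum>y\<in>S. if y ! k = i then \<epsilon> * c y else 0)"
      unfolding marginal_def sum_PQ c'_Q using that A(2) z_len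
      by (simp add: c'_P nth_append cong: sum.cong if_cong)
    also have "(\<Sum>x\<in>A. \<Sum>j<n. if F j ! k = i then a x / real n else 0) = (1 - \<epsilon>) / real n"
      using sum_bij_indicator[OF neutral_familyD(4)[OF F n that(1)] that(2)]
      by (simp add: sum_a flip: sum_divide_distrib)
    also have "(\<Sum>y\<in>S. if y ! k = i then \<epsilon> * c y else 0) = \<epsilon> * marginal S c k i"
      unfolding marginal_def sum_distrib_left by (intro sum.cong) auto
    finally show ?thesis
      by (simp add: algebra_simps diff_divide_distrib)
  qed
  have "(\<Sum>k<d + m. \<Sum>i<n. (marginal (P \<union> Q) c' k i - 1 / real n)\<^sup>2)
      = (\<Sum>k<m. \<Sum>i<n. \<epsilon>\<^sup>2 * (marginal S c k i - 1 / real n)\<^sup>2)"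
    by (simp add: sum_lessThan_add marg_head marg_tail power_mult_distrib)
  also have "\<dots> = \<epsilon>\<^sup>2 * (\<Sum>k<m. \<Sum>i<n. (marginal S c k i - 1 / real n)\<^sup>2)"
    by (simp add: sum_distrib_left)
  also have "\<dots> \<le> (\<epsilon> * \<eta>)\<^sup>2"
    using err by (simp add: power_mult_distrib mult_left_mono)
  finally have err': "(\<Sum>k<d + m. \<Sum>i<n. (marginal (P \<union> Q) c' k i - 1 / real n)\<^sup>2) \<le> (\<epsilon> * \<eta>)\<^sup>2" .
  have "\<forall>\<^sub>F \<delta> in at_right 0. \<delta> * weight \<theta>\<^sub>1 z + weight \<theta>\<^sub>2 y > 0" if "y \<in> S" for y
  proof -
    have "((\<lambda>\<delta>. \<delta> * weight \<theta>\<^sub>1 z + weight \<theta>\<^sub>2 y) \<longlongrightarrow> 0 * weight \<theta>\<^sub>1 z + weight \<theta>\<^sub>2 y) (at_right 0)"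
      by (intro tendsto_intros)
    then show ?thesis
      by (rule order_tendstoD) (simp add: S(7)[OF that])
  qed
  then have "\<forall>\<^sub>F \<delta> in at_right 0. \<forall>y\<in>S. \<delta> * weight \<theta>\<^sub>1 z + weight \<theta>\<^sub>2 y > 0"
    using S(1) by (simp add: eventually_ball_finite)
  moreover have "\<forall>\<^sub>F \<delta> :: real in at_right 0. \<delta> > 0"
    by (simp add: eventually_at_right_less)
  ultimately have "\<forall>\<^sub>F \<delta> in at_right 0. \<delta> > 0 \<and> (\<forall>y\<in>S. \<delta> * weight \<theta>\<^sub>1 z + weight \<theta>\<^sub>2 y > 0)"
    by eventually_elim auto
  then obtain \<delta> where \<delta>: "\<delta> > 0" "\<And>y. y \<in> S \<Longrightarrow> \<delta> * weight \<theta>\<^sub>1 z + weight \<theta>\<^sub>2 y > 0"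
    using eventually_happens' trivial_limit_at_right_real by blast
  let ?\<theta> = "map (\<lambda>t i. \<delta> * t i) \<theta>\<^sub>1 @ \<theta>\<^sub>2"
  have "unstable_design n (d + m) ?\<theta> (P \<union> Q) c'"
    unfolding unstable_design_def
  proof (intro conjI ballI)
    show "P \<union> Q \<subseteq> states n (d + m)"
      using A(2,3) S(2,3) z_len neutral_familyD(1,2)[OF F] by (auto simp: P_def Q_def states_def) blast+
    have sepz: "x[k := 0] = y[k := 0] \<Longrightarrow> x = y" if "x \<in> insert z A" "y \<in> insert z A" for x y k
      using sep1 that unfolding separated_def by blast
    have sepS: "x[k := 0] = y[k := 0] \<Longrightarrow> x = y" if "x \<in> S" "y \<in> S" for x y k
      using S(8) that unfolding separated_def by blast
    show "separated (P \<union> Q)"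
      unfolding separated_def
    proof (intro ballI allI impI)
      fix w w' k assume w: "w \<in> P \<union> Q" and w': "w' \<in> P \<union> Q" and eq: "w[k := 0] = w'[k := 0]"
      obtain x u where x: "w = x @ u" "x \<in> insert z A" "length x = d"
        and xu: "(x \<in> A \<and> (\<exists>i<n. u = F i)) \<or> (x = z \<and> u \<in> S)"
        using w A(2) z_len by (auto simp: P_def Q_def)
      obtain x' u' where x': "w' = x' @ u'" "x' \<in> insert z A" "length x' = d"
        and xu': "(x' \<in> A \<and> (\<exists>i<n. u' = F i)) \<or> (x' = z \<and> u' \<in> S)"
        using w' A(2) z_len by (auto simp: P_def Q_def)
      \<comment> \<open>A change in the head leaves the continuations equal. A change in the tail
        leaves the heads equal, so both continuations come from the neutral family or both from
        \<open>S\<close>.\<close>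
      show "w = w'"
      proof (cases "k < d")
        case True
        then have "x[k := 0] = x'[k := 0]" "u = u'"
          using eq x(3) x'(3) by (auto simp: x(1) x'(1) list_update_append)
        then show ?thesis
          using sepz[OF x(2) x'(2)] x(1) x'(1) by simp
      next
        case False
        then have *: "x = x'" "u[k - d := 0] = u'[k - d := 0]"
          using eq x(3) x'(3) by (auto simp: x(1) x'(1) list_update_append)
        have "u = u'"
        proof (cases "x = z")
          case True
          then show ?thesis
            using * xu xu' xz sepS by metis
        next
          case False
          then obtain i j where "i < n" "u = F i" "j < n" "u' = F j"
            using xu xu' * by auto
          then show ?thesis
            using * neutral_familyD(5)[OF F] by blast
        qed
        with * show ?thesis
          by (simp add: x(1) x'(1))
      qed
    qed
    show "c' w \<ge> 0" if "w \<in> P \<union> Q" for w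
      using that A(4) S(4) \<epsilon> by (auto simp: P_def Q_def c'_P c'_Q)
    show "length ?\<theta> = d + m"
      by (simp add: A(5) S(5))
    show "traceless n ?\<theta>"
      using traceless_scale[OF A(6)] S(6) unfolding traceless_def by auto
    show "weight ?\<theta> w > 0" if "w \<in> P \<union> Q" for w
      using that
    proof
      assume "w \<in> P"
      then obtain x i where x: "x \<in> A" "i < n" "w = x @ F i"
        by (auto simp: P_def)
      then have "weight ?\<theta> w = \<delta> * weight \<theta>\<^sub>1 x"
        by (simp add: weight_append A(2,5) weight_scale neutral_familyD(3)[OF F])
      then show ?thesis
        using \<delta>(1) A(7) x by simp
    next
      assume "w \<in> Q"
      then show ?thesis
        using \<delta>(2) by (auto simp: Q_def weight_append A(5) z_len weight_scale)
    qed
  qed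
  moreover have "\<exists>F. neutral_family n (d + m) ?\<theta> F" if b
    using fam1[OF that] neutral_family_append[OF _ F A(5)] by blast
  ultimately show ?thesis
    unfolding tail_block_def using sum_c' err' by blast
qed

text \<open>Rescaling the weights to total mass one spreads the defect \<open>\<epsilon>\<close> of every marginal.\<close>

lemma tail_block_of_head_block:
  assumes head: "head_block n d \<epsilon> b" and "\<epsilon> < 1" "n > 0"
  shows "tail_block n d (sqrt (real d * (1 - 1 / real n)) * \<epsilon> / (1 - \<epsilon>)) b"
proof -
  obtain S c \<theta> z where des: "unstable_design n d \<theta> S c" and z: "z \<in> states n d" "z \<notin> S"
    and sum_c: "sum c S = 1 - \<epsilon>"
    and marg: "\<And>k i. k < d \<Longrightarrow> i < n \<Longrightarrow> marginal S c k i + (if z ! k = i then \<epsilon> else 0) = 1 / real n"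
    and fam: "b \<Longrightarrow> \<exists>F. neutral_family n d \<theta> F"
    using head unfolding head_block_def by blast
  define c' where "c' x = c x / (1 - \<epsilon>)" for x
  have marg': "marginal S c' k i - 1 / real n = \<epsilon> / (1 - \<epsilon>) * (1 / real n - (if i = z ! k then 1 else 0))"
    if "k < d" "i < n" for k i
  proof -
    have "marginal S c' k i = marginal S c k i / (1 - \<epsilon>)"
      unfolding marginal_def c'_def sum_divide_distrib by (intro sum.cong) auto
    also have "marginal S c k i = 1 / real n - \<epsilon> * (if i = z ! k then 1 else 0)"
      using marg[OF that] by (auto split: if_splits)
    finally have eq: "marginal S c' k i = (1 / real n - \<epsilon> * (if i = z ! k then 1 else 0)) / (1 - \<epsilon>)" .
    show ?thesis
      unfolding eq using assms(2,3) by (simp add: field_simps)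
  qed
  \<comment> \<open>The squared distance between the uniform distribution and a point mass; each of
    the \<open>d\<close> factors contributes it once.\<close>
  have sq: "(\<Sum>i<n. (1 / real n - (if i = z ! k then 1 else 0))\<^sup>2) = 1 - 1 / real n" if "k < d" for k
  proof -
    have "z ! k < n"
      using z(1) that by (auto simp: states_def subset_iff)
    have "(\<Sum>i<n. (1 / real n - (if i = z ! k then 1 else 0))\<^sup>2)
        = (\<Sum>i<n. 1 / (real n)\<^sup>2 + (if i = z ! k then 1 - 2 / real n else 0))"
      by (intro sum.cong refl) (simp add: power2_eq_square algebra_simps)
    also have "\<dots> = real n / (real n)\<^sup>2 + (1 - 2 / real n)"
      using \<open>z ! k < n\<close> by (simp add: sum.distrib)
    also have "\<dots> = 1 - 1 / real n"
      using assms(3) by (simp add: field_simps power2_eq_square)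
    finally show ?thesis .
  qed
  have "(\<Sum>i<n. (marginal S c' k i - 1 / real n)\<^sup>2) = (\<epsilon> / (1 - \<epsilon>))\<^sup>2 * (1 - 1 / real n)"
    if "k < d" for k
  proof -
    have "(\<Sum>i<n. (marginal S c' k i - 1 / real n)\<^sup>2)
        = (\<Sum>i<n. (\<epsilon> / (1 - \<epsilon>))\<^sup>2 * (1 / real n - (if i = z ! k then 1 else 0))\<^sup>2)"
      using marg'[OF that] by (intro sum.cong refl) (simp only: lessThan_iff power_mult_distrib)
    also have "\<dots> = (\<epsilon> / (1 - \<epsilon>))\<^sup>2 * (1 - 1 / real n)"
      using sq[OF that] by (simp only: flip: sum_distrib_left)
    finally show ?thesis .
  qed
  then have "(\<Sum>k<d. \<Sum>i<n. (marginal S c' k i - 1 / real n)\<^sup>2)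
      = (\<epsilon> / (1 - \<epsilon>))\<^sup>2 * (real d * (1 - 1 / real n))"
    by simp
  also have "\<dots> = (sqrt (real d * (1 - 1 / real n)) * \<epsilon> / (1 - \<epsilon>))\<^sup>2"
    using assms by (simp add: power_mult_distrib power_divide)
  finally have err: "(\<Sum>k<d. \<Sum>i<n. (marginal S c' k i - 1 / real n)\<^sup>2)
      \<le> (sqrt (real d * (1 - 1 / real n)) * \<epsilon> / (1 - \<epsilon>))\<^sup>2"
    by simp
  have "sum c' S = 1"
    using sum_c assms by (simp add: c'_def flip: sum_divide_distrib)
  moreover have "unstable_design n d \<theta> S c'"
    using des assms by (simp add: unstable_design_def c'_def)
  ultimately show ?thesis
    unfolding tail_block_def using err fam by blast
qed

text \<open>Repeating every state leaves room for a neutral family: the weights \<open>\<theta>\<close> may be split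
  arbitrarily between the two copies.\<close>

theorem head_block_double:
  assumes head: "head_block n d \<epsilon> b" and d: "d > 0" and n: "n > 0"
  shows "head_block n (d + d) \<epsilon> True"
proof -
  obtain S c \<theta> z where des: "unstable_design n d \<theta> S c" and z: "z \<in> states n d" "z \<notin> S"
    and \<epsilon>: "0 \<le> \<epsilon>" and sum_c: "sum c S = 1 - \<epsilon>"
    and marg: "\<And>k i. k < d \<Longrightarrow> i < n \<Longrightarrow> marginal S c k i + (if z ! k = i then \<epsilon> else 0) = 1 / real n"
    using head unfolding head_block_def by blast
  have S: "\<And>x. x \<in> S \<Longrightarrow> length x = d" "\<And>x. x \<in> S \<Longrightarrow> set x \<subseteq> {..<n}"
    "\<And>x. x \<in> S \<Longrightarrow> c x \<ge> 0" "length \<theta> = d" "traceless n \<theta>" "\<And>x. x \<in> S \<Longrightarrow> weight \<theta> x > 0"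
    using des by (auto simp: unstable_design_def states_def)
  have z_len: "length z = d" "set z \<subseteq> {..<n}"
    using z by (auto simp: states_def)
  \<comment> \<open>The weight of the constant list with entry \<open>i\<close>.\<close>
  define \<Theta> where "\<Theta> i = (\<Sum>k<d. (\<theta> ! k) i)" for i
  have "(\<Sum>i<n. \<Theta> i) = (\<Sum>k<d. \<Sum>i<n. (\<theta> ! k) i)"
    unfolding \<Theta>_def by (rule sum.swap)
  also have "\<dots> = 0"
    using S(4,5) by (simp add: traceless_def)
  finally have sum_\<Theta>: "(\<Sum>i<n. \<Theta> i) = 0" .
  \<comment> \<open>A traceless solution of the cyclic difference equation
    \<open>\<Psi> i - \<Psi> (i + 1) = \<Theta> i\<close>; it closes up modulo \<open>n\<close>
    because \<Theta> sums to zero.\<close>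
  define \<Psi> where "\<Psi> i = (\<Sum>i'<n. \<Sum>j<i'. \<Theta> j) / real n - (\<Sum>j<i. \<Theta> j)" for i
  have sum_\<Psi>: "(\<Sum>i<n. \<Psi> i) = 0"
    using n by (simp add: \<Psi>_def sum_subtractf)
  have \<Psi>_step: "\<Theta> i - \<Psi> i + \<Psi> (Suc i mod n) = 0" if "i < n" for i
  proof (cases "Suc i = n")
    case True
    then have "(\<Sum>j<i. \<Theta> j) + \<Theta> i = 0"
      using sum_\<Theta> by auto
    with True show ?thesis
      by (simp add: \<Psi>_def)
  next
    case False
    with that show ?thesis
      by (simp add: \<Psi>_def)
  qed
  \<comment> \<open>The potential \<Psi> is moved from the first copy to the second. On a doubled
    state \<open>x @ x\<close> the two contributions cancel, so its weight stays
    \<open>weight \<theta> x\<close>.\<close>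
  define \<phi> where "\<phi> = map (\<lambda>t i. t i - \<Psi> i / real d) \<theta>"
  define \<psi> where "\<psi> = replicate d (\<lambda>i. \<Psi> i / real d)"
  have len: "length \<phi> = d" "length \<psi> = d"
    by (auto simp: \<phi>_def \<psi>_def S(4))
  have w: "weight (\<phi> @ \<psi>) (x @ y) = weight \<theta> x - (\<Sum>k<d. \<Psi> (x ! k) / real d) + (\<Sum>k<d. \<Psi> (y ! k) / real d)"
    if "length x = d" "length y = d" for x y
  proof -
    have "weight \<phi> x = weight \<theta> x - (\<Sum>k<d. \<Psi> (x ! k) / real d)"
      using that S(4) by (simp add: weight_nth \<phi>_def sum_subtractf)
    moreover have "weight \<psi> y = (\<Sum>k<d. \<Psi> (y ! k) / real d)"
      using that by (simp add: weight_nth \<psi>_def)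
    moreover have "weight (\<phi> @ \<psi>) (x @ y) = weight \<phi> x + weight \<psi> y"
      using that by (simp add: weight_append len)
    ultimately show ?thesis
      by simp
  qed
  define T where "T = (\<lambda>x. x @ x) ` S"
  define c' where "c' x = c (take d x)" for x
  have inj: "inj_on (\<lambda>x. x @ x) S"
    using S(1) by (auto simp: inj_on_def)
  have sum_T: "sum g T = (\<Sum>x\<in>S. g (x @ x))" for g :: "nat list \<Rightarrow> real"
    unfolding T_def by (subst sum.reindex[OF inj]) (simp add: o_def)
  have c': "c' (x @ y) = c x" if "x \<in> S" for x y
    using S(1)[OF that] by (simp add: c'_def)
  \<comment> \<open>Distinct doubled states differ in both copies, hence in at least two places,
    whatever the original states are.\<close>
  have sepT: "separated ((\<lambda>x. x @ x) ` insert z S)"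
    unfolding separated_def using S(1) z_len by (auto simp: list_update_append split: if_splits)
  have "unstable_design n (d + d) (\<phi> @ \<psi>) T c'"
    unfolding unstable_design_def
  proof (intro conjI ballI)
    show "T \<subseteq> states n (d + d)"
      using S(1,2) by (fastforce simp: T_def states_def)
    show "separated T"
      using sepT by (simp add: T_def separated_def)
    show "c' x \<ge> 0" if "x \<in> T" for x
      using that S(3) by (auto simp: T_def c')
    show "length (\<phi> @ \<psi>) = d + d"
      by (simp add: len)
    show "traceless n (\<phi> @ \<psi>)"
      using S(5) sum_\<Psi> by (auto simp: traceless_def \<phi>_def \<psi>_def sum_subtractf simp flip: sum_divide_distrib)
    show "weight (\<phi> @ \<psi>) x > 0" if "x \<in> T" for x
      using that S(1,6) by (auto simp: T_def w)
  qed
  moreover have "z @ z \<in> states n (d + d)"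
    using z_len by (simp add: states_def)
  moreover have "z @ z \<notin> T"
  proof
    assume "z @ z \<in> T"
    then obtain x where x: "x \<in> S" "z @ z = x @ x"
      by (auto simp: T_def)
    then have "z = x"
      using S(1)[OF x(1)] z_len(1) by simp
    with x z(2) show False
      by simp
  qed
  moreover have "separated (insert (z @ z) T)"
    using sepT by (simp add: T_def)
  moreover have "sum c' T = 1 - \<epsilon>"
    by (simp add: sum_T c' sum_c)
  moreover have "marginal T c' k i + (if (z @ z) ! k = i then \<epsilon> else 0) = 1 / real n"
    if "k < d + d" "i < n" for k i
  proof -
    define k' where "k' = (if k < d then k else k - d)"
    have k': "k' < d" "\<And>x. length x = d \<Longrightarrow> (x @ x) ! k = x ! k'"
      using that by (auto simp: k'_def nth_append)
    have "marginal T c' k i = marginal S c k' i"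
      unfolding marginal_def sum_T by (intro sum.cong refl) (simp add: k'(2) S(1) c')
    then show ?thesis
      using marg[OF k'(1) that(2)] by (simp add: k'(2) z_len)
  qed
  \<comment> \<open>The cyclic shift between the halves is essential: on equal halves \<Psi> would
    cancel, whereas here it contributes exactly \<open>- \<Theta> i\<close>.\<close>
  moreover have "neutral_family n (d + d) (\<phi> @ \<psi>) (\<lambda>i. replicate d i @ replicate d (Suc i mod n))"
    unfolding neutral_family_def
  proof (intro conjI allI impI)
    fix i assume i: "i < n"
    show "replicate d i @ replicate d (Suc i mod n) \<in> states n (d + d)"
      using i by (auto simp: states_def)
    have "weight (\<phi> @ \<psi>) (replicate d i @ replicate d (Suc i mod n)) = \<Theta> i - \<Psi> i + \<Psi> (Suc i mod n)"
      using d by (simp add: w weight_nth S(4) \<Theta>_def)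
    then show "weight (\<phi> @ \<psi>) (replicate d i @ replicate d (Suc i mod n)) = 0"
      using \<Psi>_step[OF i] by simp
    fix j k
    assume j: "j < n" and eq: "(replicate d i @ replicate d (Suc i mod n))[k := 0]
      = (replicate d j @ replicate d (Suc j mod n))[k := 0]"
    then have "i = j \<or> Suc i mod n = Suc j mod n"
      using d by (auto simp: list_update_append split: if_splits)
    then show "i = j"
      using i j by (auto simp: mod_Suc split: if_splits)
  next
    fix k assume k: "k < d + d"
    have inj: "inj_on (\<lambda>i. Suc i mod n) {..<n}"
      by (auto simp: inj_on_def mod_Suc split: if_splits)
    have "bij_betw (\<lambda>i. Suc i mod n) {..<n} {..<n}"
      unfolding bij_betw_def using inj n by (intro conjI endo_inj_surj) auto
    moreover have "bij_betw (\<lambda>i. i) {..<n} {..<n}"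
      by (simp add: bij_betw_def)
    ultimately show "bij_betw (\<lambda>i. (replicate d i @ replicate d (Suc i mod n)) ! k) {..<n} {..<n}"
      using k by (cases "k < d") (simp_all add: nth_append)
  qed
  ultimately show ?thesis
    unfolding head_block_def using \<epsilon> by blast
qed

section \<open>The blocks for qubits\<close>

lemma lessThan_2: "{..<2 :: nat} = {0, 1}"
  by auto

lemma bij_betw_flip: "bij_betw (\<lambda>i. 1 - i) {..<2 :: nat} {..<2}"
  by (auto simp: bij_betw_def inj_on_def lessThan_2)

lemma bij_betw_same: "bij_betw (\<lambda>i. i) {..<n :: nat} {..<n}"
  by (simp add: bij_betw_def)

abbreviation spin :: "real \<Rightarrow> nat \<Rightarrow> real" where
  "spin t \<equiv> \<lambda>i. if i = 0 then - t else t"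

lemma neutral_family_2: "neutral_family 2 2 [spin 1, spin 1] (\<lambda>i. [i, 1 - i])"
  unfolding neutral_family_def
proof (intro conjI allI impI)
  show "bij_betw (\<lambda>i. [i, 1 - i] ! k) {..<2 :: nat} {..<2}" if "k < 2" for k
    using that bij_betw_flip bij_betw_same[of 2] by (cases k) auto
qed (auto simp: states_def weight_def less_2_cases_iff split: nat.splits)

text \<open>The first two spins cancel on equal entries, as in the support used in
  \<open>tail_block_3\<close>; on opposite entries they add up and cancel the third spin.\<close>

lemma neutral_family_3:
  "neutral_family 2 3 [spin (1/2), spin (-1/2), spin (-1)] (\<lambda>i. [i, 1 - i, i])"
  unfolding neutral_family_def
proof (intro conjI allI impI)
  show "bij_betw (\<lambda>i. [i, 1 - i, i] ! k) {..<2 :: nat} {..<2}" if "k < 3" for k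
  proof -
    have "k = 0 \<or> k = 1 \<or> k = 2"
      using that by auto
    then show ?thesis
      using bij_betw_flip bij_betw_same[of 2] by auto
  qed
qed (auto simp: states_def weight_def less_2_cases_iff split: nat.splits)

lemma unstable_design_2: "c \<ge> 0 \<Longrightarrow> unstable_design 2 2 [spin 1, spin 1] {[1, 1]} (\<lambda>_. c)"
  by (auto simp: unstable_design_def states_def separated_def traceless_def weight_def lessThan_2)

text \<open>One half of a Bell state: mass \<open>1/2\<close> at \<open>[1, 1]\<close> lacks exactly
  the mass \<open>1/2\<close> at \<open>[0, 0]\<close> for uniform marginals.\<close>

lemma head_block_2: "head_block 2 2 (1/2) True"
  unfolding head_block_def
proof (intro exI conjI)
  show "unstable_design 2 2 [spin 1, spin 1] {[1, 1]} (\<lambda>_. 1/2)"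
    by (rule unstable_design_2) simp
  show "separated (insert [0, 0] {[1, 1]})"
    by (auto simp: separated_def split: nat.splits)
  show "\<forall>k<2. \<forall>i<2. marginal {[1, 1]} (\<lambda>_. 1/2) k i + (if [0, 0] ! k = i then 1/2 else 0) = 1 / real 2"
    by (auto simp: marginal_def less_2_cases_iff)
  show "True \<longrightarrow> (\<exists>F. neutral_family 2 2 [spin 1, spin 1] F)"
    using neutral_family_2 by blast
qed (auto simp: states_def)

lemma tail_block_2: "tail_block 2 2 1 True"
  unfolding tail_block_def
proof (intro exI conjI)
  show "unstable_design 2 2 [spin 1, spin 1] {[1, 1]} (\<lambda>_. 1)"
    by (rule unstable_design_2) simp
  show "True \<longrightarrow> (\<exists>F. neutral_family 2 2 [spin 1, spin 1] F)"
    using neutral_family_2 by blast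
qed (auto simp: marginal_def lessThan_2 power2_eq_square)

text \<open>A Bell pair times a basis vector: only the third factor deviates from uniform, by
  \<open>1/2\<close> at each of its two values.\<close>

lemma tail_block_3: "tail_block 2 3 (1 / sqrt 2) True"
  unfolding tail_block_def
proof (intro exI conjI)
  let ?S = "{[0, 0, 0], [1, 1, 0]}"
  show "unstable_design 2 3 [spin (1/2), spin (-1/2), spin (-1)] ?S (\<lambda>_. 1/2)"
    by (auto simp: unstable_design_def states_def separated_def traceless_def weight_def lessThan_2
        split: nat.splits)
  have "{..<3 :: nat} = {0, 1, 2}"
    by auto
  then show "(\<Sum>k<3. \<Sum>i<2. (marginal ?S (\<lambda>_. 1/2) k i - 1 / real 2)\<^sup>2) \<le> (1 / sqrt 2)\<^sup>2"
    by (simp add: marginal_def lessThan_2 power2_eq_square)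
  show "True \<longrightarrow> (\<exists>F. neutral_family 2 3 [spin (1/2), spin (-1/2), spin (-1)] F)"
    using neutral_family_3 by blast
qed auto

text \<open>Every additional pair of qubits halves the deviation; the parity of \<open>d\<close>
  decides whether the stack ends in a block of two or of three qubits.\<close>

lemma tail_block_qubits: "d \<ge> 2 \<Longrightarrow> tail_block 2 d (2 powr (- (real d / 2) + 1)) True"
proof (induction d rule: less_induct)
  case (less d)
  consider "d = 2" | "d = 3" | "d \<ge> 4"
    using less.prems by linarith
  then show ?case
  proof cases
    case 1
    then show ?thesis
      using tail_block_2 by simp
  next
    case 2
    have "2 powr (- (real 3 / 2) + 1) = (2 powr (- (1/2)) :: real)"
      by simp
    also have "\<dots> = 1 / sqrt 2"
      by (simp only: powr_minus powr_half_sqrt) (simp add: divide_inverse)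
    finally show ?thesis
      using 2 tail_block_3 by simp
  next
    case 3
    then have "tail_block 2 (2 + (d - 2)) (1/2 * 2 powr (- (real (d - 2) / 2) + 1)) True"
      using less.IH[of "d - 2"] tail_block_append[OF head_block_2, of "d - 2"] by simp
    moreover have "1/2 * 2 powr (- (real (d - 2) / 2) + 1) = (2 powr (- (real d / 2) + 1) :: real)"
    proof -
      have "2 powr (- (real (d - 2) / 2) + 1) = (2 powr 1 * 2 powr (- (real d / 2) + 1) :: real)"
        using 3 by (simp only: powr_add[symmetric]) (simp add: of_nat_diff field_simps)
      then show ?thesis
        by simp
    qed
    moreover have "2 + (d - 2) = d"
      using 3 by simp
    ultimately show ?thesis
      by simp
  qed
qed

section \<open>The block of three factors for arbitrary \<open>n\<close>\<close>

lemma sum_powers_of_2: "(\<Sum>s<n. 2 ^ s) = (2 ^ n - 1 :: real)"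
  by (induction n) auto

lemma sum_powers_of_2_rev: "(\<Sum>s<n. 2 ^ (n - Suc s)) = (2 ^ n - 1 :: real)"
  using sum.nat_diff_reindex[of "\<lambda>s. 2 ^ s :: real" n] by (simp add: sum_powers_of_2)

lemma sum_indicator_from_1:
  fixes g :: "nat \<Rightarrow> real"
  shows "(\<Sum>s\<in>{1..<n}. if s = i then g s else 0) = (if 1 \<le> i \<and> i < n then g i else 0)"
  by simp

text \<open>The lowered first entry \<open>s - 1\<close> of the third kind links consecutive levels:
  in the first factor, level \<open>i\<close> receives mass from the indices \<open>i\<close> and
  \<open>i + 1\<close>, which is the source of the doubling of masses.\<close>

definition ladder_states :: "nat \<Rightarrow> nat list set" where
  "ladder_states n = (\<lambda>s. [s, 0, s]) ` {1..<n} \<union> (\<lambda>s. [s, s, 0]) ` {1..<n} \<union> (\<lambda>s. [s - 1, s, s]) ` {1..<n}"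

text \<open>Uniform marginals away from \<open>[0, 0, 0]\<close> force the masses \<open>\<alpha>\<close>, \<open>\<alpha>\<close> and
  \<open>1 / n - \<alpha>\<close> of the three states with index \<open>s\<close>, where \<open>\<alpha> s\<close> doubles with every step
  and \<open>2 * \<alpha> (n - 1) = 1 / n\<close>.\<close>

definition ladder_mass :: "nat \<Rightarrow> nat list \<Rightarrow> real" where
  "ladder_mass n x = (let \<alpha> = \<lambda>s. 2 ^ s / (real n * 2 ^ n) in
     if x ! 1 = 0 \<or> x ! 2 = 0 then \<alpha> (x ! 0) else 1 / real n - \<alpha> (x ! 1))"

lemma sum_ladder_states:
  fixes g :: "nat list \<Rightarrow> real"
  shows "sum g (ladder_states n) = (\<Sum>s\<in>{1..<n}. g [s, 0, s] + g [s, s, 0] + g [s - 1, s, s])"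
proof -
  let ?I = "{1..<n}"
  have "sum g (ladder_states n)
      = sum g ((\<lambda>s. [s, 0, s]) ` ?I) + sum g ((\<lambda>s. [s, s, 0]) ` ?I) + sum g ((\<lambda>s. [s - 1, s, s]) ` ?I)"
    unfolding ladder_states_def by (subst sum.union_disjoint; (subst sum.union_disjoint)?) auto
  then show ?thesis
    by (simp add: sum.reindex inj_on_def sum.distrib)
qed

text \<open>Any two of the three entries determine the remaining one.\<close>

lemma separated_ladder: "separated (insert [0, 0, 0] (ladder_states n))"
  unfolding separated_def
proof (intro ballI allI impI)
  fix x y k
  assume x: "x \<in> insert [0, 0, 0] (ladder_states n)" and y: "y \<in> insert [0, 0, 0] (ladder_states n)"
    and eq: "x[k := 0] = y[k := 0]"
  \<comment> \<open>The state \<open>[0, 0, 0]\<close> fits the first pattern with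
    \<open>s = 0\<close>; the bound in the third pattern keeps the truncated subtraction
    \<open>s - 1\<close> injective.\<close>
  have form: "\<exists>s. w = [s, 0, s] \<or> w = [s, s, 0] \<or> (w = [s - 1, s, s] \<and> s \<ge> 1)"
    if "w \<in> insert [0, 0, 0] (ladder_states n)" for w
    using that by (auto simp: ladder_states_def)
  obtain s where s: "x = [s, 0, s] \<or> x = [s, s, 0] \<or> (x = [s - 1, s, s] \<and> s \<ge> 1)"
    using form[OF x] by blast
  obtain t where t: "y = [t, 0, t] \<or> y = [t, t, 0] \<or> (y = [t - 1, t, t] \<and> t \<ge> 1)"
    using form[OF y] by blast
  consider "k = 0" | "k = 1" | "k = 2" | "k \<ge> 3"
    by linarith
  then show "x = y"
  proof cases
    case 1
    with eq s t show ?thesis by (elim disjE) auto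
  next
    case 2
    with eq s t show ?thesis by (elim disjE) auto
  next
    case 3
    with eq s t show ?thesis by (elim disjE) (auto simp: numeral_2_eq_2)
  next
    case 4
    have "length x = 3" "length y = 3"
      using s t by auto
    with 4 eq show ?thesis by (simp add: list_update_beyond)
  qed
qed

text \<open>The tuple \<open>[x, y, y]\<close> in the proof gives all states of the ladder the same weight \<open>1 / n\<close>.\<close>

lemma head_block_ladder:
  assumes n: "n \<ge> 2"
  shows "head_block n 3 (2 / (real n * 2 ^ n)) False"
proof -
  define \<alpha> where "\<alpha> s = 2 ^ s / (real n * 2 ^ n)" for s :: nat
  define p :: real where "p = 2 ^ (n - 1)"
  have pn: "2 ^ n = 2 * p"
    using n by (simp add: p_def power_eq_if)
  have p: "p > 0"
    by (simp add: p_def)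
  \<comment> \<open>Equal weights on the three kinds of states force
    \<open>2 * (y s - y 0) = y (s - 1) - y 0\<close> for \<open>s \<ge> 2\<close>, which is solved
    by powers of two; \<open>Q\<close> is the shift that makes \<open>y\<close> traceless.\<close>
  define Q where "Q = (p - 1) / real n"
  define x where "x s = 2 * Q + 1 / real n - 2 ^ (n - Suc s)" for s
  \<comment> \<open>At \<open>s = 0\<close> the term \<open>p\<close> cancels the power of two, so
    that \<open>y 0 = - Q\<close>.\<close>
  define y where "y s = 2 ^ (n - Suc s) - Q - (if s = 0 then p else 0)" for s
  have mass: "ladder_mass n [s, 0, s] = \<alpha> s" "ladder_mass n [s, s, 0] = \<alpha> s"
    "s \<ge> 1 \<Longrightarrow> ladder_mass n [s - 1, s, s] = 1 / real n - \<alpha> s" for s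
    by (auto simp: ladder_mass_def \<alpha>_def)
  note mass' = mass[unfolded One_nat_def]
  have \<alpha>_Suc: "\<alpha> (Suc s) = 2 * \<alpha> s" for s
    by (simp add: \<alpha>_def)
  have \<alpha>_last: "2 * \<alpha> (n - 1) = 1 / real n"
    unfolding \<alpha>_def pn using n p by (simp add: p_def)
  have \<epsilon>: "2 / (real n * 2 ^ n) = \<alpha> 1"
    by (simp add: \<alpha>_def)
  have sum_\<alpha>: "(\<Sum>s\<in>{1..<n}. \<alpha> s) = 1 / real n - \<alpha> 1"
  proof -
    have "(\<Sum>s\<in>{1..<n}. 2 ^ s) = (2 ^ n - 2 :: real)"
      using sum_powers_of_2[of n] n sum.atLeast_Suc_lessThan[of 0 n "\<lambda>s. 2 ^ s :: real"]
      by (simp add: atLeast0LessThan)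
    then have "(\<Sum>s\<in>{1..<n}. \<alpha> s) = (2 ^ n - 2) / (real n * 2 ^ n)"
      by (simp add: \<alpha>_def flip: sum_divide_distrib)
    then show ?thesis
      using n by (simp add: \<alpha>_def field_simps)
  qed
  have \<alpha>_le: "\<alpha> s \<le> 1 / real n" if "s < n" for s
    using that n by (simp add: \<alpha>_def divide_simps power_increasing)
  have \<alpha>_nonneg: "\<alpha> s \<ge> 0" for s
    by (simp add: \<alpha>_def)
  have "unstable_design n 3 [x, y, y] (ladder_states n) (ladder_mass n)"
    unfolding unstable_design_def
  proof (intro conjI ballI)
    show "ladder_states n \<subseteq> states n 3"
      using n by (auto simp: ladder_states_def states_def)
    show "separated (ladder_states n)"
      using separated_ladder[of n] by (simp add: separated_def)
    show "ladder_mass n w \<ge> 0" if "w \<in> ladder_states n" for w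
      using that \<alpha>_le \<alpha>_nonneg by (auto simp: ladder_states_def mass')
    have "(\<Sum>s<n. x s) = real n * (2 * Q + 1 / real n) - (2 ^ n - 1)"
      by (simp add: x_def sum_subtractf sum_powers_of_2_rev)
    then have "(\<Sum>s<n. x s) = 0"
      using n by (simp add: pn Q_def field_simps)
    moreover have "(\<Sum>s<n. y s) = 2 ^ n - 1 - real n * Q - p"
      using n by (simp add: y_def sum_subtractf sum_powers_of_2_rev)
    then have "(\<Sum>s<n. y s) = 0"
      using n by (simp add: pn Q_def field_simps)
    ultimately show "traceless n [x, y, y]"
      by (simp add: traceless_def)
    show "weight [x, y, y] w > 0" if "w \<in> ladder_states n" for w
    proof -
      have pow: "2 ^ (n - s) = (2 * 2 ^ (n - Suc s) :: real)" if "s < n" for s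
        using that by (simp add: Suc_diff_Suc flip: power_Suc)
      have "weight [x, y, y] [s, 0, s] = 1 / real n" "weight [x, y, y] [s, s, 0] = 1 / real n"
        "weight [x, y, y] [s - 1, s, s] = 1 / real n" if "s \<in> {1..<n}" for s
        using that pow[of s] by (simp_all add: weight_def x_def y_def p_def)
      then have "weight [x, y, y] w = 1 / real n"
        using \<open>w \<in> ladder_states n\<close> unfolding ladder_states_def by blast
      then show ?thesis
        using n by simp
    qed
  qed simp
  moreover have "[0, 0, 0] \<in> states n 3"
    using n by (simp add: states_def)
  moreover have "[0, 0, 0] \<notin> ladder_states n"
    by (auto simp: ladder_states_def)
  moreover have "separated (insert [0, 0, 0] (ladder_states n))"
    by (rule separated_ladder)
  moreover have "sum (ladder_mass n) (ladder_states n) = 1 - \<alpha> 1"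
  proof -
    have "sum (ladder_mass n) (ladder_states n) = (\<Sum>s\<in>{1..<n}. \<alpha> s + 1 / real n)"
      unfolding sum_ladder_states by (intro sum.cong refl) (simp add: mass del: One_nat_def)
    also have "\<dots> = 1 / real n - \<alpha> 1 + real (n - 1) / real n"
      by (simp only: sum.distrib sum_\<alpha>) simp
    also have "\<dots> = 1 - \<alpha> 1"
      using n by (simp add: of_nat_diff field_simps)
    finally show ?thesis .
  qed
  moreover have "marginal (ladder_states n) (ladder_mass n) k i + (if [0, 0, 0] ! k = i then \<alpha> 1 else 0) = 1 / real n"
    if k: "k < 3" and i: "i < n" for k i
  proof -
    have "k = 0 \<or> k = 1 \<or> k = 2"
      using k by auto
    moreover have "marginal (ladder_states n) (ladder_mass n) 0 i + (if 0 = i then \<alpha> 1 else 0) = 1 / real n"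
    proof -
      \<comment> \<open>Level \<open>i\<close> collects two masses \<open>\<alpha> i\<close> and the
        mass \<open>1 / n - \<alpha> (i + 1)\<close>; doubling balances them, and at the top level
        \<open>2 * \<alpha> (n - 1) = 1 / n\<close> takes over.\<close>
      have "marginal (ladder_states n) (ladder_mass n) 0 i
          = (\<Sum>s\<in>{1..<n}. (if s = i then 2 * \<alpha> s else 0) + (if s = Suc i then 1 / real n - \<alpha> s else 0))"
        unfolding marginal_def sum_ladder_states by (intro sum.cong refl) (auto simp: mass' mass'(3)[of "Suc 0", simplified])
      also have "\<dots> = (if 1 \<le> i then 2 * \<alpha> i else 0) + (if Suc i < n then 1 / real n - \<alpha> (Suc i) else 0)"
        unfolding sum.distrib sum_indicator_from_1 using i by simp
      finally show ?thesis
        using n i \<alpha>_last by (cases "Suc i = n") (auto simp: \<alpha>_Suc not_le less_Suc0)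
    qed
    moreover have "marginal (ladder_states n) (ladder_mass n) k i + (if 0 = i then \<alpha> 1 else 0) = 1 / real n"
      if "k = 1 \<or> k = 2" for k
    proof -
      \<comment> \<open>In the last two factors the masses \<open>\<alpha> s\<close> and
        \<open>1 / n - \<alpha> s\<close> meet at entry \<open>s\<close>, and the other mass
        \<open>\<alpha> s\<close> falls on entry \<open>0\<close>.\<close>
      have "marginal (ladder_states n) (ladder_mass n) k i
          = (\<Sum>s\<in>{1..<n}. (if 0 = i then \<alpha> s else 0) + (if s = i then 1 / real n else 0))"
        unfolding marginal_def sum_ladder_states
      proof (rule sum.cong[OF refl])
        fix s assume "s \<in> {1..<n}"
        then have s: "s \<ge> 1"
          by simp
        have "[s, 0, s] ! k = (if k = 1 then 0 else s)" "[s, s, 0] ! k = (if k = 1 then s else 0)"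
          "[s - 1, s, s] ! k = s"
          using that by auto
        then show "(if [s, 0, s] ! k = i then ladder_mass n [s, 0, s] else 0)
            + (if [s, s, 0] ! k = i then ladder_mass n [s, s, 0] else 0)
            + (if [s - 1, s, s] ! k = i then ladder_mass n [s - 1, s, s] else 0)
            = (if 0 = i then \<alpha> s else 0) + (if s = i then 1 / real n else 0)"
          using s by (simp only: mass(1,2) mass(3)[OF s]) simp
      qed
      also have "\<dots> = (if 0 = i then 1 / real n - \<alpha> 1 else 0) + (if 1 \<le> i then 1 / real n else 0)"
        unfolding sum.distrib sum_indicator_from_1 using i by (simp add: sum_\<alpha>[unfolded One_nat_def])
      finally show ?thesis
        by auto
    qed
    ultimately show ?thesis
      by auto
  qed
  ultimately show ?thesis
    unfolding head_block_def \<epsilon> using \<alpha>_nonneg[of 1] by blast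
qed

section \<open>The bounds on the gap\<close>

lemma gap_le_of_tail_block:
  assumes "tail_block CARD('n::finite) CARD('d::finite) \<eta> b" "\<eta> \<ge> 0"
  shows "weight_margin TYPE('n) TYPE('d) \<le> gap TYPE('n) TYPE('d)" "gap TYPE('n) TYPE('d) \<le> \<eta>"
proof -
  obtain v :: "('n, 'd) tensor" where v: "v \<noteq> 0" "destabilized v" "norm (moment_G v) \<le> \<eta>"
    using assms by (rule tensor_of_tail_block)
  then have "unstable SL_tuples v"
    by (intro destabilized_imp_unstable_SL)
  with v show "weight_margin TYPE('n) TYPE('d) \<le> gap TYPE('n) TYPE('d)" "gap TYPE('n) TYPE('d) \<le> \<eta>"
    using weight_margin_le_gap[of v] gap_le[of v] by auto
qed

lemma tail_block_mono: "tail_block n d \<eta> b \<Longrightarrow> 0 \<le> \<eta> \<Longrightarrow> \<eta> \<le> \<eta>' \<Longrightarrow> tail_block n d \<eta>' b"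
  unfolding tail_block_def by (meson order_trans power_mono)

text \<open>With \<open>\<epsilon> = q / n\<close> and \<open>q \<le> 1\<close> the rescaling factor
  is \<open>\<epsilon> / (1 - \<epsilon>) = q / (n - q)\<close>, hence at most
  \<open>q / (n - 1)\<close>. This is the origin of the denominator \<open>n - 1\<close>.\<close>

lemma normalised_ladder_bound:
  assumes n: "n \<ge> 3"
  defines "\<epsilon> \<equiv> 2 / (real n * 2 ^ n)"
  shows "0 < \<epsilon>" "\<epsilon> < 1" "0 \<le> sqrt (real d * (1 - 1 / real n)) * \<epsilon> / (1 - \<epsilon>)"
    "sqrt (real d * (1 - 1 / real n)) * \<epsilon> / (1 - \<epsilon>) \<le> sqrt (real d) / (real n - 1) * (2 / 2 ^ n)"
proof -
  define q :: real where "q = 2 / 2 ^ n"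
  have "(2 :: real) ^ 1 \<le> 2 ^ n"
    using n by (intro power_increasing) auto
  then have q: "0 < q" "q \<le> 1"
    by (auto simp: q_def)
  have eq: "\<epsilon> = q / real n"
    by (simp add: \<epsilon>_def q_def)
  show pos: "0 < \<epsilon>" and lt: "\<epsilon> < 1"
    using n q by (auto simp: eq divide_simps)
  then show "0 \<le> sqrt (real d * (1 - 1 / real n)) * \<epsilon> / (1 - \<epsilon>)"
    using n by simp
  have "\<epsilon> / (1 - \<epsilon>) = q / (real n - q)"
    using n q by (simp add: eq field_simps)
  also have "\<dots> \<le> q / (real n - 1)"
    using n q by (intro divide_left_mono) auto
  finally have 1: "\<epsilon> / (1 - \<epsilon>) \<le> q / (real n - 1)" .
  have 2: "sqrt (real d * (1 - 1 / real n)) \<le> sqrt (real d)"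
    using n by (intro real_sqrt_le_mono mult_left_le) auto
  have "sqrt (real d * (1 - 1 / real n)) * (\<epsilon> / (1 - \<epsilon>)) \<le> sqrt (real d) * (q / (real n - 1))"
    using pos lt by (intro mult_mono 1 2) auto
  then show "sqrt (real d * (1 - 1 / real n)) * \<epsilon> / (1 - \<epsilon>) \<le> sqrt (real d) / (real n - 1) * (2 / 2 ^ n)"
    by (simp add: q_def mult.commute)
qed

lemma two_powr_eq: "2 powr (- real n + 1) = (2 / 2 ^ n :: real)"
  by (simp only: powr_add powr_minus powr_realpow divide_inverse) (simp add: powr_realpow)

lemma tail_block_ladder_3:
  assumes n: "n \<ge> 3"
  shows "tail_block n 3 (2 powr (- real n + 1)) False"
proof -
  let ?\<epsilon> = "2 / (real n * 2 ^ n)"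
  note bd = normalised_ladder_bound(1,2)[OF n] normalised_ladder_bound(3,4)[OF n, of 3]
  \<comment> \<open>Here \<open>n \<ge> 3\<close> enters: it lets the denominator
    \<open>n - 1\<close> absorb \<open>sqrt 3\<close>.\<close>
  have "sqrt 3 \<le> 2"
    by (intro real_le_lsqrt) auto
  also have "2 \<le> real n - 1"
    using n by simp
  finally have "sqrt 3 \<le> real n - 1" .
  then have "sqrt (real 3) / (real n - 1) * (2 / 2 ^ n) \<le> 2 / 2 ^ n"
    using n by (intro mult_left_le_one_le) (auto simp: divide_simps)
  with bd(4) have "sqrt (real 3 * (1 - 1 / real n)) * ?\<epsilon> / (1 - ?\<epsilon>) \<le> 2 powr (- real n + 1)"
    using n by (simp only: two_powr_eq)
  moreover have "tail_block n 3 (sqrt (real 3 * (1 - 1 / real n)) * ?\<epsilon> / (1 - ?\<epsilon>)) False"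
    using n bd(2) by (intro tail_block_of_head_block head_block_ladder) auto
  ultimately show ?thesis
    using tail_block_mono bd(3) by blast
qed

text \<open>One plain ladder heads a stack of \<open>r - 1\<close> doubled ladders, the innermost of
  which is rescaled and yields \<open>sqrt 6\<close>. Only the outermost block may lack a neutral
  family.\<close>

lemma tail_block_ladders:
  assumes n: "n \<ge> 3" and r: "r \<ge> 2"
  shows "tail_block n (6 * r - 3)
    (sqrt 6 / ((real n - 1) * sqrt (real r)) * 2 powr (- (real r * (real n - 1)) + 1)) False"
proof -
  define \<epsilon> where "\<epsilon> = 2 / (real n * 2 ^ n)"
  define \<eta> where "\<eta> = sqrt (real 6 * (1 - 1 / real n)) * \<epsilon> / (1 - \<epsilon>)"
  note bd = normalised_ladder_bound(1,2)[OF n, folded \<epsilon>_def]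
    normalised_ladder_bound(3,4)[OF n, of 6, folded \<epsilon>_def, folded \<eta>_def]
  have head3: "head_block n 3 \<epsilon> False"
    unfolding \<epsilon>_def using n by (intro head_block_ladder) auto
  then have head6: "head_block n 6 \<epsilon> True"
    using head_block_double[OF head3] n by simp
  have tail: "tail_block n (6 * Suc m) (\<epsilon> ^ m * \<eta>) True" for m
  proof (induction m)
    case 0
    show ?case
      using tail_block_of_head_block[OF head6 bd(2)] n by (simp add: \<eta>_def)
  next
    case (Suc m)
    then show ?case
      using tail_block_append[OF head6 Suc] n by (simp add: mult.assoc add.commute)
  qed
  obtain m where m: "r = m + 2"
    using r by (metis add.commute le_Suc_ex)
  have "tail_block n (3 + 6 * Suc m) (\<epsilon> * (\<epsilon> ^ m * \<eta>)) False"
    using n by (intro tail_block_append[OF head3 tail]) auto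
  then have tb: "tail_block n (6 * r - 3) (\<epsilon> ^ (r - 1) * \<eta>) False"
    by (simp add: m mult.assoc)
  define q :: real where "q = 2 / 2 ^ n"
  have q: "q > 0"
    by (simp add: q_def)
  have "\<epsilon> ^ (r - 1) * \<eta> \<le> \<epsilon> ^ (r - 1) * (sqrt (real 6) / (real n - 1) * q)"
    using bd(1,4) by (intro mult_left_mono) (auto simp: q_def)
  also have "\<dots> = sqrt 6 / (real n - 1) * (q ^ r / real n ^ (r - 1))"
    by (simp add: \<epsilon>_def q_def m power_divide power_mult_distrib mult_ac)
  also have "\<dots> \<le> sqrt 6 / (real n - 1) * (2 * q ^ r / sqrt (real r))"
  proof (rule mult_left_mono)
    \<comment> \<open>Each of the \<open>r - 1\<close> factors \<open>\<epsilon> = q / n\<close>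
      brings a denominator \<open>n\<close>; their product exceeds \<open>sqrt r\<close>.\<close>
    have "real r \<le> 2 ^ (r - 1)"
      using less_exp[of "r - 1"] r by (metis Suc_leI Suc_diff_1 of_nat_le_iff of_nat_numeral of_nat_power
          less_le_trans pos2)
    also have "\<dots> \<le> real n ^ (r - 1)"
      using n by (intro power_mono) auto
    finally have "real r \<le> real n ^ (r - 1)" .
    moreover have "sqrt (real r) \<le> real r"
      using r by (intro real_le_lsqrt) (auto simp: power2_eq_square)
    ultimately have le: "sqrt (real r) \<le> 2 * real n ^ (r - 1)"
      by linarith
    have pos: "0 < real n ^ (r - 1)" "0 < sqrt (real r)" "0 < q ^ r"
      using n r q by auto
    have "q ^ r * sqrt (real r) \<le> q ^ r * (2 * real n ^ (r - 1))"
      using le pos by (intro mult_left_mono) auto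
    then show "q ^ r / real n ^ (r - 1) \<le> 2 * q ^ r / sqrt (real r)"
      using pos by (simp add: frac_le_eq divide_le_eq field_simps)
  qed (use n in auto)
  also have "\<dots> = sqrt 6 / ((real n - 1) * sqrt (real r)) * (2 * q ^ r)"
    by simp
  also have "2 * q ^ r = 2 powr (- (real r * (real n - 1)) + 1)"
  proof -
    have "q = 2 powr (- real n + 1)"
      by (simp only: two_powr_eq q_def)
    then have "q powr real r = 2 powr (- (real r * (real n - 1)))"
      by (simp add: powr_powr algebra_simps)
    then have "q ^ r = 2 powr (- (real r * (real n - 1)))"
      using powr_realpow[OF q] by simp
    then show ?thesis
      by (simp only: powr_add) simp
  qed
  finally show ?thesis
    using tb bd(1,3) by (intro tail_block_mono[OF tb]) auto
qed

theorem theorem4p11: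
  shows
    "(CARD('n::finite) = 2 \<and> CARD('d::finite) \<ge> 3 \<longrightarrow>
        weight_margin TYPE('n) TYPE('d) \<le> gap TYPE('n) TYPE('d) \<and>
        gap TYPE('n) TYPE('d) \<le> 2 powr (- (real CARD('d) / 2) + 1)) \<and>
     (CARD('n) \<ge> 3 \<and> CARD('d) = 3 \<longrightarrow>
        weight_margin TYPE('n) TYPE('d) \<le> gap TYPE('n) TYPE('d) \<and>
        gap TYPE('n) TYPE('d) \<le> 2 powr (- real CARD('n) + 1)) \<and>
     (\<forall>r::nat. CARD('n) \<ge> 3 \<and> r \<ge> 2 \<and> CARD('d) = 6 * r - 3 \<longrightarrow>
        weight_margin TYPE('n) TYPE('d) \<le> gap TYPE('n) TYPE('d) \<and>
        gap TYPE('n) TYPE('d) \<le>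
          sqrt 6 / ((real CARD('n) - 1) * sqrt (real r)) * 2 powr (- (real r * (real CARD('n) - 1)) + 1) \<and>
        sqrt 6 / ((real CARD('n) - 1) * sqrt (real r)) * 2 powr (- (real r * (real CARD('n) - 1)) + 1)
          \<le> 2 powr (- (real r * (real CARD('n) - 1)) + 1) \<and>
        2 powr (- (real r * (real CARD('n) - 1)) + 1) =
          2 powr (- ((real CARD('d) + 3) * (real CARD('n) - 1) / 6) + 1))"
proof (intro conjI impI allI; elim conjE)
  assume n: "CARD('n) = 2" and d: "CARD('d) \<ge> 3"
  have "tail_block CARD('n) CARD('d) (2 powr (- (real CARD('d) / 2) + 1)) True"
    using tail_block_qubits[of "CARD('d)"] n d by simp
  note * = gap_le_of_tail_block[OF this]
  show "weight_margin TYPE('n) TYPE('d) \<le> gap TYPE('n) TYPE('d)"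
    "gap TYPE('n) TYPE('d) \<le> 2 powr (- (real CARD('d) / 2) + 1)"
    using * by simp_all
next
  assume n: "CARD('n) \<ge> 3" and d: "CARD('d) = 3"
  have "tail_block CARD('n) CARD('d) (2 powr (- real CARD('n) + 1)) False"
    using tail_block_ladder_3[OF n] d by simp
  note * = gap_le_of_tail_block[OF this]
  show "weight_margin TYPE('n) TYPE('d) \<le> gap TYPE('n) TYPE('d)"
    "gap TYPE('n) TYPE('d) \<le> 2 powr (- real CARD('n) + 1)"
    using * by simp_all
next
  fix r :: nat
  assume n: "CARD('n) \<ge> 3" and r: "r \<ge> 2" and d: "CARD('d) = 6 * r - 3"
  let ?b = "sqrt 6 / ((real CARD('n) - 1) * sqrt (real r))"
  let ?e = "2 powr (- (real r * (real CARD('n) - 1)) + 1) :: real"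
  have n1: "real CARD('n) - 1 \<ge> 2"
    using n by simp
  have b0: "?b * ?e \<ge> 0"
    using n1 by (intro mult_nonneg_nonneg divide_nonneg_nonneg) auto
  have "tail_block CARD('n) CARD('d) (?b * ?e) False"
    using tail_block_ladders[OF n r] d by simp
  note * = gap_le_of_tail_block[OF this b0]
  show "weight_margin TYPE('n) TYPE('d) \<le> gap TYPE('n) TYPE('d)" "gap TYPE('n) TYPE('d) \<le> ?b * ?e"
    using * by simp_all
  \<comment> \<open>The comparison value eight is \<open>(n - 1)\<^sup>2 * r\<close> at the smallest
    parameters \<open>n = 3\<close>, \<open>r = 2\<close>.\<close>
  have "sqrt 6 \<le> sqrt (2\<^sup>2 * 2)"
    by simp
  also have "\<dots> = 2 * sqrt 2"
    by (simp only: real_sqrt_mult real_sqrt_abs)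
  also have "\<dots> \<le> (real CARD('n) - 1) * sqrt (real r)"
    using n1 r by (intro mult_mono real_sqrt_le_mono) auto
  finally have "?b \<le> 1"
    by (rule divide_le_eq_1_pos[THEN iffD2, rotated]) (use n1 r in auto)
  then show "?b * ?e \<le> ?e"
    using n1 by (intro mult_left_le_one_le) auto
  have "real CARD('d) + 3 = 6 * real r"
    using d r by (simp add: of_nat_diff)
  then show "?e = 2 powr (- ((real CARD('d) + 3) * (real CARD('n) - 1) / 6) + 1)"
    by simp
qed

end
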